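(* Let $\tau<\mathfrak{c}$ be a cardinal number. Assume that $\langle K_\alpha,\pi_\alpha^\beta\colon\alpha\le\beta\le\delta\rangle$ is an inverse system of $\tau$-simple extensions with $\delta\le\mathfrak{c}$. Then $K_\delta$ has the finitely supported Josefson--Nissenzweig property.
   Context: All compact spaces are Hausdorff; $\mathfrak{c}=2^\omega$ is the continuum (also viewed as an initial ordinal); $w(X)$ is the weight of $X$; $\partial A$ is the boundary of $A$. For a cardinal $\tau\le\mathfrak{c}$, an inverse system $\langle K_\alpha,\pi_\alpha^\beta\colon\alpha\le\beta\le\delta\rangle$ (with $\delta$ an ordinal and $\pi_\alpha^\beta\colon K_\beta\to K_\alpha$ continuous bonding maps) of totally disconnected compact spaces is a system of $\tau$-simple extensions if: (i) it is continuous, i.e. for every limit ordinal $\gamma\le\delta$ the space $K_\gamma$ is the limit of the inverse system $\langle K_\alpha,\pi_\alpha^\beta\colon\alpha\le\beta<\gamma\rangle$ (with $\pi_\alpha^\gamma$ the canonical projections); (ii) $K_0=2^\omega$ and each $K_\alpha$ is perfect, i.e. has no isolated points; (iii) for every $\alpha<\delta$, $K_{\alpha+1}$ is a $\tau$-simple extension of $K_\alpha$, i.e. $\big|\partial\pi_\alpha^{\alpha+1}[U]\setminus\pi_\alpha^{\alpha+1}[\partial U]\big|\le\tau$ for every closed subset $U\subseteq K_{\alpha+1}$; (iv) the map $\pi_\alpha^\beta$ is irreducible (a continuous surjection such that no proper closed subset of $K_\beta$ is mapped onto $K_\alpha$) for every $\alpha<\beta\le\delta$; (v) $w(K_\alpha)=w(K_{\alpha+1})$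 for every $\alpha<\delta$. A compact space $K$ has the finitely supported Josefson--Nissenzweig property (fsJNP) if there is a sequence $\langle\mu_n\colon n\in\omega\rangle$ of finitely supported signed Radon measures on $K$ such that $\|\mu_n\|=1$ (total variation norm) for all $n$ and $\lim_n\int_K f\,d\mu_n=0$ for every $f\in C(K)$. *)

theory Defs
  imports "HOL-Analysis.Analysis"
begin

unbundle cardinal_syntax

section \<open>Cardinals and ordinals\<close>

text \<open>Cardinals are represented as in the library, by well-order relations \<open>r\<close> with
  \<^term>\<open>Card_order r\<close>; since \<^term>\<open>|A|\<close> is an initial ordinal, the relation \<open>\<le>o\<close> also
  compares arbitrary ordinals with it.\<close>

abbreviation continuum :: "nat set rel" where
  "continuum \<equiv> |UNIV :: nat set set|"

text \<open>Ordinals are points of a type of class \<^class>\<open>wellorder\<close>; the point \<open>\<alpha>\<close> stands for the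
  order type of the set of its predecessors. The value of \<open>ord_succ \<alpha>\<close> is meaningful only if
  \<open>\<alpha>\<close> is not the last point of the type.\<close>

definition ord_zero :: "'i::wellorder" where
  "ord_zero = (LEAST \<alpha>. True)"

definition ord_succ :: "'i::wellorder \<Rightarrow> 'i" where
  "ord_succ \<alpha> = (LEAST \<beta>. \<alpha> < \<beta>)"

definition ord_limit :: "'i::wellorder \<Rightarrow> bool" where
  "ord_limit \<gamma> \<longleftrightarrow> \<gamma> \<noteq> ord_zero \<and> (\<forall>\<alpha><\<gamma>. ord_succ \<alpha> < \<gamma>)"

definition ordinal_of :: "'i::wellorder \<Rightarrow> 'i rel" where
  "ordinal_of \<delta> = {(\<alpha>, \<beta>). \<alpha> \<le> \<beta> \<and> \<beta> < \<delta>}"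

lemma Well_order_ordinal_of: "Well_order (ordinal_of \<delta>)"
proof -
  have F: "Field (ordinal_of \<delta>) = {..<\<delta>}"
    by (auto simp: ordinal_of_def Field_def)
  have "ordinal_of \<delta> - Id \<subseteq> {(x, y). x < y}"
    by (auto simp: ordinal_of_def)
  then have "wf (ordinal_of \<delta> - Id)"
    using wf wf_subset by blast
  then show ?thesis
    unfolding well_order_on_def linear_order_on_def partial_order_on_def preorder_on_def F
    by (auto simp: refl_on_def trans_def antisym_def total_on_def ordinal_of_def)
qed


section \<open>Topological notions\<close>

definition cantor_space :: "(nat \<Rightarrow> bool) topology" where
  "cantor_space = product_topology (\<lambda>_. discrete_topology UNIV) UNIV"

definition totally_disconnected_space :: "'a topology \<Rightarrow> bool" where
  "totally_disconnected_space X \<longleftrightarrow> (\<forall>S. connectedin X S \<longrightarrow> (\<forall>x\<in>S. \<forall>y\<in>S. x = y))"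

definition no_isolated_points :: "'a topology \<Rightarrow> bool" where
  "no_isolated_points X \<longleftrightarrow> (\<forall>x\<in>topspace X. \<not> openin X {x})"

definition topology_base :: "'a topology \<Rightarrow> 'a set set \<Rightarrow> bool" where
  "topology_base X \<B> \<longleftrightarrow>
     (\<forall>V\<in>\<B>. openin X V) \<and> (\<forall>U x. openin X U \<and> x \<in> U \<longrightarrow> (\<exists>V\<in>\<B>. x \<in> V \<and> V \<subseteq> U))"

text \<open>The weight, the least cardinality of a base; it is attained, see below.\<close>

definition weight :: "'a topology \<Rightarrow> 'a set rel" where
  "weight X = (SOME r. \<exists>\<B>. topology_base X \<B> \<and> r = |\<B>| \<and> (\<forall>\<C>. topology_base X \<C> \<longrightarrow> |\<B>| \<le>o |\<C>| ))"

lemma weight: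
  obtains \<B> where "topology_base X \<B>" "weight X = |\<B>|"
    "\<And>\<C>. topology_base X \<C> \<Longrightarrow> weight X \<le>o |\<C>|"
proof -
  define R where "R = {|\<B>| | \<B>. topology_base X \<B>}"
  have "topology_base X {U. openin X U}"
    by (auto simp: topology_base_def)
  then have "R \<noteq> {}" "\<forall>r\<in>R. Well_order r"
    by (auto simp: R_def card_of_Well_order)
  then obtain r where "r \<in> R" "\<forall>r'\<in>R. r \<le>o r'"
    using exists_minim_Well_order by blast
  then have "\<exists>r. \<exists>\<B>. topology_base X \<B> \<and> r = |\<B>| \<and> (\<forall>\<C>. topology_base X \<C> \<longrightarrow> |\<B>| \<le>o |\<C>| )"
    unfolding R_def by blast
  from someI_ex[OF this] show ?thesis
    using that unfolding weight_def[symmetric] by auto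
qed

definition irreducible_map :: "'a topology \<Rightarrow> 'b topology \<Rightarrow> ('a \<Rightarrow> 'b) \<Rightarrow> bool" where
  "irreducible_map X Y f \<longleftrightarrow>
     continuous_map X Y f \<and> f ` topspace X = topspace Y \<and>
     (\<forall>C. closedin X C \<and> f ` C = topspace Y \<longrightarrow> C = topspace X)"

definition simple_extension :: "'t rel \<Rightarrow> 'a topology \<Rightarrow> 'b topology \<Rightarrow> ('b \<Rightarrow> 'a) \<Rightarrow> bool" where
  "simple_extension \<tau> X Y p \<longleftrightarrow>
     (\<forall>U. closedin Y U \<longrightarrow> |X frontier_of (p ` U) - p ` (Y frontier_of U)| \<le>o \<tau>)"


section \<open>Inverse systems\<close>

definition inverse_limit ::
  "'i::order set \<Rightarrow> ('i \<Rightarrow> 'a topology) \<Rightarrow> ('i \<Rightarrow> 'i \<Rightarrow> 'a \<Rightarrow> 'a) \<Rightarrow> ('i \<Rightarrow> 'a) topology" where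
  "inverse_limit I K \<pi> =
     subtopology (product_topology K I) {x. \<forall>\<alpha>\<in>I. \<forall>\<beta>\<in>I. \<alpha> \<le> \<beta> \<longrightarrow> \<pi> \<alpha> \<beta> (x \<beta>) = x \<alpha>}"

text \<open>Here \<open>\<pi> \<alpha> \<beta>\<close> is the bonding map from \<open>K \<beta>\<close> to \<open>K \<alpha>\<close>; the values of \<open>K\<close> and \<open>\<pi>\<close> at
  indices above \<open>\<delta>\<close> are irrelevant. As the spaces have a common type of points, the
  identifications of \<open>K ord_zero\<close> with \<open>2\<^sup>\<omega>\<close> and of \<open>K \<gamma>\<close> with the inverse limit are
  homeomorphisms, the latter being the canonical one.\<close>

locale simple_extension_system =
  fixes \<tau> :: "'t rel"
    and \<delta> :: "'i::wellorder"
    and K :: "'i \<Rightarrow> 'a topology"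
    and \<pi> :: "'i \<Rightarrow> 'i \<Rightarrow> 'a \<Rightarrow> 'a"
  assumes tau_card: "Card_order \<tau>"
    and tau_le: "\<tau> \<le>o continuum"
    and compact: "\<alpha> \<le> \<delta> \<Longrightarrow> compact_space (K \<alpha>)"
    and Hausdorff: "\<alpha> \<le> \<delta> \<Longrightarrow> Hausdorff_space (K \<alpha>)"
    and totally_disconnected: "\<alpha> \<le> \<delta> \<Longrightarrow> totally_disconnected_space (K \<alpha>)"
    and continuous: "\<alpha> \<le> \<beta> \<Longrightarrow> \<beta> \<le> \<delta> \<Longrightarrow> continuous_map (K \<beta>) (K \<alpha>) (\<pi> \<alpha> \<beta>)"
    and bonding_id: "\<alpha> \<le> \<delta> \<Longrightarrow> x \<in> topspace (K \<alpha>) \<Longrightarrow> \<pi> \<alpha> \<alpha> x = x"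
    and bonding_comp: "\<alpha> \<le> \<beta> \<Longrightarrow> \<beta> \<le> \<gamma> \<Longrightarrow> \<gamma> \<le> \<delta> \<Longrightarrow> x \<in> topspace (K \<gamma>) \<Longrightarrow>
      \<pi> \<alpha> \<beta> (\<pi> \<beta> \<gamma> x) = \<pi> \<alpha> \<gamma> x"
    and limit: "ord_limit \<gamma> \<Longrightarrow> \<gamma> \<le> \<delta> \<Longrightarrow>
      homeomorphic_map (K \<gamma>) (inverse_limit {..<\<gamma>} K \<pi>) (\<lambda>x. \<lambda>\<alpha>\<in>{..<\<gamma>}. \<pi> \<alpha> \<gamma> x)"
    and zero: "K ord_zero homeomorphic_space cantor_space"
    and perfect: "\<alpha> \<le> \<delta> \<Longrightarrow> no_isolated_points (K \<alpha>)"
    and simple: "\<alpha> < \<delta> \<Longrightarrow>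
      simple_extension \<tau> (K \<alpha>) (K (ord_succ \<alpha>)) (\<pi> \<alpha> (ord_succ \<alpha>))"
    and irreducible: "\<alpha> < \<beta> \<Longrightarrow> \<beta> \<le> \<delta> \<Longrightarrow> irreducible_map (K \<beta>) (K \<alpha>) (\<pi> \<alpha> \<beta>)"
    and weight_eq: "\<alpha> < \<delta> \<Longrightarrow> weight (K \<alpha>) =o weight (K (ord_succ \<alpha>))"


section \<open>Signed Radon measures\<close>

definition borel_of :: "'a topology \<Rightarrow> 'a measure" where
  "borel_of X = sigma (topspace X) {U. openin X U}"

text \<open>Signed measures are real-valued, hence finite; only their values on \<^term>\<open>sets M\<close> matter.\<close>

definition signed_measure :: "'a measure \<Rightarrow> ('a set \<Rightarrow> real) \<Rightarrow> bool" where
  "signed_measure M \<mu> \<longleftrightarrow>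
     \<mu> {} = 0 \<and>
     (\<forall>A :: nat \<Rightarrow> 'a set. range A \<subseteq> sets M \<and> disjoint_family A \<longrightarrow>
        (\<lambda>n. \<mu> (A n)) sums \<mu> (\<Union>n. A n))"

text \<open>The positive part of the Jordan decomposition; \<^const>\<open>ennreal\<close> sends negative reals to
  \<open>0\<close>, which is harmless since the empty set takes part in the supremum.\<close>

definition positive_part :: "'a measure \<Rightarrow> ('a set \<Rightarrow> real) \<Rightarrow> 'a measure" where
  "positive_part M \<mu> =
     measure_of (space M) (sets M) (\<lambda>A. SUP B\<in>{B \<in> sets M. B \<subseteq> A}. ennreal (\<mu> B))"

lemma emeasure_positive_part:
  assumes \<mu>: "signed_measure M \<mu>" and A: "A \<in> sets M"
  shows "emeasure (positive_part M \<mu>) A = (SUP B\<in>{B \<in> sets M. B \<subseteq> A}. ennreal (\<mu> B))"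
proof -
  define p where "p A = (SUP B\<in>{B \<in> sets M. B \<subseteq> A}. ennreal (\<mu> B))" for A
  have upper: "ennreal (\<mu> B) \<le> p A" if "B \<in> sets M" "B \<subseteq> A" for A B
    using that unfolding p_def by (intro SUP_upper) auto
  have empty: "\<mu> {} = 0"
    using \<mu> by (simp add: signed_measure_def)
  have sums: "(\<lambda>n. \<mu> (E n)) sums \<mu> (\<Union>n. E n)"
    if "range E \<subseteq> sets M" "disjoint_family E" for E :: "nat \<Rightarrow> 'a set"
    using \<mu> that by (simp add: signed_measure_def)
  have add: "\<mu> (B \<union> C) = \<mu> B + \<mu> C" if "B \<in> sets M" "C \<in> sets M" "B \<inter> C = {}" for B C
  proof -
    have "(\<lambda>n. \<mu> (binaryset B C n)) sums \<mu> (\<Union>n. binaryset B C n)"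
      using that by (intro sums) (auto simp: binaryset_def disjoint_family_on_def)
    then have "(\<lambda>n. \<mu> (binaryset B C n)) sums \<mu> (B \<union> C)"
      by (simp add: UN_binaryset_eq)
    moreover have "(\<lambda>n. \<mu> (binaryset B C n)) sums (\<mu> B + \<mu> C)"
      using binaryset_sums[of \<mu> B C] empty by simp
    ultimately show ?thesis
      using sums_unique2 by blast
  qed
  have p_empty: "p {} = 0"
    unfolding p_def by (rule antisym[OF SUP_least]) (auto simp: empty)
  have superadd: "p A + p B \<le> p (A \<union> B)" if AB: "A \<in> sets M" "B \<in> sets M" "A \<inter> B = {}" for A B
  proof -
    have *: "ennreal (\<mu> C) + ennreal (\<mu> D) \<le> p (A \<union> B)"
      if "C \<in> sets M" "C \<subseteq> A" "D \<in> sets M" "D \<subseteq> B" for C D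
    proof -
      define C' where "C' = (if \<mu> C \<ge> 0 then C else {})"
      define D' where "D' = (if \<mu> D \<ge> 0 then D else {})"
      have "ennreal (\<mu> C) + ennreal (\<mu> D) = ennreal (\<mu> C') + ennreal (\<mu> D')"
        by (auto simp: C'_def D'_def empty ennreal_neg)
      also have "\<dots> = ennreal (\<mu> C' + \<mu> D')"
        by (rule ennreal_plus[symmetric]) (auto simp: C'_def D'_def empty)
      also have "\<mu> C' + \<mu> D' = \<mu> (C' \<union> D')"
        using that AB by (intro add[symmetric]) (auto simp: C'_def D'_def)
      also have "ennreal \<dots> \<le> p (A \<union> B)"
        using that by (intro upper) (auto simp: C'_def D'_def)
      finally show ?thesis .
    qed
    have "p A + p B = (SUP C\<in>{C \<in> sets M. C \<subseteq> A}. ennreal (\<mu> C) + p B)"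
      unfolding p_def[of A] by (subst ennreal_SUP_add_left) auto
    also have "\<dots> \<le> p (A \<union> B)"
    proof (rule SUP_least)
      fix C assume C: "C \<in> {C \<in> sets M. C \<subseteq> A}"
      have "ennreal (\<mu> C) + p B = (SUP D\<in>{D \<in> sets M. D \<subseteq> B}. ennreal (\<mu> C) + ennreal (\<mu> D))"
        unfolding p_def[of B] by (subst ennreal_SUP_add_right) auto
      also have "\<dots> \<le> p (A \<union> B)"
        using C by (intro SUP_least *) auto
      finally show "ennreal (\<mu> C) + p B \<le> p (A \<union> B)" .
    qed
    finally show ?thesis .
  qed
  have "countably_additive (sets M) p"
    unfolding countably_additive_def
  proof safe
    fix E :: "nat \<Rightarrow> 'a set"
    assume E: "range E \<subseteq> sets M" "disjoint_family E"
    show "(\<Sum>n. p (E n)) = p (\<Union>n. E n)"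
    proof (rule antisym)
      have "(\<Sum>i<n. p (E i)) \<le> p (\<Union>i<n. E i)" for n
      proof (induction n)
        case (Suc n)
        have "(\<Sum>i<Suc n. p (E i)) \<le> p (\<Union>i<n. E i) + p (E n)"
          using Suc by (simp add: add_right_mono)
        also have "\<dots> \<le> p ((\<Union>i<n. E i) \<union> E n)"
        proof (rule superadd)
          have "E i \<inter> E n = {}" if "i < n" for i
            using E(2) that by (intro disjoint_family_onD[OF E(2)]) auto
          then show "(\<Union>i<n. E i) \<inter> E n = {}"
            by blast
          show "(\<Union>i<n. E i) \<in> sets M" "E n \<in> sets M"
            using E(1) by (auto intro!: sets.finite_UN)
        qed
        also have "(\<Union>i<n. E i) \<union> E n = (\<Union>i<Suc n. E i)"
          by (auto simp: lessThan_Suc)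
        finally show ?case .
      qed (simp add: p_empty)
      also have "p (\<Union>i<n. E i) \<le> p (\<Union>n. E n)" for n
        unfolding p_def by (rule SUP_subset_mono) auto
      finally show "(\<Sum>n. p (E n)) \<le> p (\<Union>n. E n)"
        by (intro suminf_le_const) auto
    next
      show "p (\<Union>n. E n) \<le> (\<Sum>n. p (E n))"
        unfolding p_def[of "\<Union>n. E n"]
      proof (rule SUP_least)
        fix B assume B: "B \<in> {B \<in> sets M. B \<subseteq> (\<Union>n. E n)}"
        have "(\<lambda>n. \<mu> (B \<inter> E n)) sums \<mu> (\<Union>n. B \<inter> E n)"
          using B E by (intro sums) (auto simp: disjoint_family_on_def)
        also have "(\<Union>n. B \<inter> E n) = B"
          using B by auto
        finally have lim: "(\<lambda>n. ennreal (\<Sum>i<n. \<mu> (B \<inter> E i))) \<longlonglongrightarrow> ennreal (\<mu> B)"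
          by (intro tendsto_ennrealI) (simp add: sums_def)
        show "ennreal (\<mu> B) \<le> (\<Sum>n. p (E n))"
        proof (rule LIMSEQ_le_const2[OF lim], intro exI allI impI)
          fix n
          have "ennreal (\<Sum>i<n. \<mu> (B \<inter> E i)) \<le> ennreal (\<Sum>i<n. max 0 (\<mu> (B \<inter> E i)))"
            by (intro ennreal_leI sum_mono) auto
          also have "\<dots> = (\<Sum>i<n. ennreal (max 0 (\<mu> (B \<inter> E i))))"
            by (subst sum_ennreal) auto
          also have "\<dots> \<le> (\<Sum>i<n. p (E i))"
            using B E by (intro sum_mono) (auto simp: max_def intro!: upper)
          also have "\<dots> \<le> (\<Sum>n. p (E n))"
            by (intro sum_le_suminf) auto
          finally show "ennreal (\<Sum>i<n. \<mu> (B \<inter> E i)) \<le> (\<Sum>n. p (E n))" .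
        qed
      qed
    qed
  qed
  then have "emeasure (measure_of (space M) (sets M) p) A = p A"
    using A p_empty by (intro emeasure_measure_of_sigma) (auto simp: positive_def sets.sigma_algebra_axioms)
  then show ?thesis
    unfolding positive_part_def p_def .
qed

definition negative_part :: "'a measure \<Rightarrow> ('a set \<Rightarrow> real) \<Rightarrow> 'a measure" where
  "negative_part M \<mu> = positive_part M (\<lambda>A. - \<mu> A)"

definition variation :: "'a measure \<Rightarrow> ('a set \<Rightarrow> real) \<Rightarrow> 'a set \<Rightarrow> ennreal" where
  "variation M \<mu> A = emeasure (positive_part M \<mu>) A + emeasure (negative_part M \<mu>) A"

definition total_variation_norm :: "'a measure \<Rightarrow> ('a set \<Rightarrow> real) \<Rightarrow> ennreal" where
  "total_variation_norm M \<mu> = variation M \<mu> (space M)"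

definition signed_integral :: "'a measure \<Rightarrow> ('a set \<Rightarrow> real) \<Rightarrow> ('a \<Rightarrow> real) \<Rightarrow> real" where
  "signed_integral M \<mu> f = (LINT x|positive_part M \<mu>. f x) - (LINT x|negative_part M \<mu>. f x)"

text \<open>Outer regularity follows from inner regularity by passing to complements.\<close>

definition signed_Radon_measure :: "'a topology \<Rightarrow> ('a set \<Rightarrow> real) \<Rightarrow> bool" where
  "signed_Radon_measure X \<mu> \<longleftrightarrow>
     signed_measure (borel_of X) \<mu> \<and>
     (\<forall>A\<in>sets (borel_of X). \<forall>\<epsilon>>0. \<exists>C\<in>sets (borel_of X).
        compactin X C \<and> C \<subseteq> A \<and> variation (borel_of X) \<mu> (A - C) < \<epsilon>)"

definition measure_support :: "'a topology \<Rightarrow> ('a set \<Rightarrow> real) \<Rightarrow> 'a set" where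
  "measure_support X \<mu> =
     {x \<in> topspace X. \<forall>U. openin X U \<and> x \<in> U \<longrightarrow> variation (borel_of X) \<mu> U > 0}"

definition fsJNP :: "'a topology \<Rightarrow> bool" where
  "fsJNP X \<longleftrightarrow> (\<exists>\<mu> :: nat \<Rightarrow> 'a set \<Rightarrow> real.
     (\<forall>n. signed_Radon_measure X (\<mu> n) \<and> finite (measure_support X (\<mu> n)) \<and>
          total_variation_norm (borel_of X) (\<mu> n) = 1) \<and>
     (\<forall>f. continuous_map X euclideanreal f \<longrightarrow>
          (\<lambda>n. signed_integral (borel_of X) (\<mu> n) f) \<longlonglongrightarrow> 0))"

end

theory Submission
  imports Defs
begin

text \<open>The idea is that the space at the top looks, from the point of view of any single clopen
  set, like the Cantor space up to a null set. Let \<open>f\<close> be the projection of \<open>K \<delta>\<close> onto the bottom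
  space, identified with the Cantor space, and let \<open>U\<close> be clopen in \<open>K \<delta>\<close>.

  The points of the Cantor space whose fibre is split by \<open>U\<close> form the closed set \<open>f ` U \<inter> f ` (- U)\<close>, and
  the key fact is that it has fewer than continuum many points (\<open>card_overlap_zero\<close>).
  Consider the images of \<open>U\<close> and of its complement at every stage. By irreducibility, their
  intersection is the boundary of the image of \<open>U\<close>. At the top it is empty, it cannot become empty at
  a limit stage, and at a successor stage at most \<open>\<tau>\<close> of its points are resolved, because the extension
  is simple. Hence every split point at the bottom can be charged to one of fewer than continuum many
  steps (\<open>overlap_zero_origin\<close>).

  A closed subset of the Cantor space with fewer than continuum many points is countable, hence null
  (\<open>small_closed_cantor_countable\<close>, \<open>countable_closed_null\<close>). It follows that, as \<open>n\<close> grows, all but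
  a vanishing proportion of the cylinders of level \<open>n\<close> meet only one of \<open>f ` U\<close> and
  \<open>f ` (- U)\<close> (\<open>common_cylinders_density\<close>).

  Now place in \<open>K \<delta>\<close> two points above each of the \<open>2 ^ n\<close> cylinders of level \<open>n\<close>, with opposite weights of
  modulus \<open>1 / 2 ^ Suc n\<close>. The resulting measure has norm 1, and the two weights over a cylinder cancel
  on \<open>U\<close> unless the cylinder meets both images. So the measures converge to zero on clopen sets, and,
  as \<open>K \<delta>\<close> is zero-dimensional, on continuous functions (\<open>fsJNP_if_small_overlaps\<close>).\<close>


section \<open>Cardinal estimates and points of well-orders\<close>

lemma ord_succ_props:
  fixes \<alpha> \<beta> :: "'i::wellorder"
  assumes "\<alpha> < \<beta>"
  shows less_ord_succ: "\<alpha> < ord_succ \<alpha>" and ord_succ_le: "ord_succ \<alpha> \<le> \<beta>"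
  unfolding ord_succ_def using assms by (auto intro: LeastI Least_le)

lemma ord_zero_le: "ord_zero \<le> (\<alpha> :: 'i::wellorder)"
  unfolding ord_zero_def by (simp add: Least_le)

lemma ord_cases:
  fixes \<alpha> :: "'i::wellorder"
  obtains "\<alpha> = ord_zero" | "ord_limit \<alpha>" | \<zeta> where "\<zeta> < \<alpha>" "\<alpha> = ord_succ \<zeta>"
  unfolding ord_limit_def by (metis ord_succ_le order_le_less)

lemma card_of_finite_less_infinite: "finite A \<Longrightarrow> infinite B \<Longrightarrow> |A| <o |B|"
  by (meson card_of_ordLess finite_imageD finite_subset)

text \<open>A proper initial segment of an ordinal that does not exceed an initial ordinal has smaller
  cardinality. This is what makes lengths up to and including the continuum possible: every stage
  strictly before the end has fewer than continuum many predecessors.\<close>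

lemma card_of_atMost_less:
  fixes \<eta> \<delta> :: "'i::wellorder"
  assumes "\<eta> < \<delta>" and "ordinal_of \<delta> \<le>o |C|" and "infinite C"
  shows "|{..\<eta>}| <o |C|"
proof -
  let ?r = "ordinal_of \<delta>"
  have W: "Well_order ?r"
    by (rule Well_order_ordinal_of)
  have F: "Field ?r = {..<\<delta>}"
    by (auto simp: ordinal_of_def Field_def)
  have u: "underS ?r \<eta> = {..<\<eta>}"
    using assms(1) by (auto simp: underS_def ordinal_of_def)
  have R: "Field (Restr ?r {..<\<eta>}) = {..<\<eta>}"
    using assms(1) by (auto simp: ordinal_of_def Field_def)
  have "Restr ?r {..<\<eta>} <o ?r"
    using underS_Restr_ordLess[OF W, of \<eta>] assms(1) unfolding u F by auto
  moreover have "|{..<\<eta>}| \<le>o Restr ?r {..<\<eta>}"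
    using Well_order_Restr[OF W, of "{..<\<eta>}"] card_of_least R by metis
  ultimately have 1: "|{..<\<eta>}| <o |C|"
    using assms(2) ordLeq_ordLess_trans ordLess_ordLeq_trans by blast
  have "|{\<eta>}| <o |C|"
    using assms(3) by (simp add: card_of_finite_less_infinite)
  moreover have "{..\<eta>} = {..<\<eta>} \<union> {\<eta>}"
    by auto
  ultimately show ?thesis
    using card_of_Un_ordLess_infinite[OF assms(3) 1] by metis
qed

text \<open>The uniform bound \<open>\<tau>\<close> on the members is essential, because \<open>|C|\<close> may be singular. The set \<open>B\<close>
  in the proof only provides an infinite cardinal below \<open>|C|\<close> that dominates both \<open>|I|\<close> and \<open>\<tau>\<close>;
  its summand \<^typ>\<open>nat\<close> matters when these are finite.\<close>

lemma card_of_UN_less_uniform: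
  assumes "infinite C" "|UNIV :: nat set| <o |C|" "|I| <o |C|" "Card_order \<tau>" "\<tau> <o |C|"
    and "\<And>i. i \<in> I \<Longrightarrow> |A i| \<le>o \<tau>"
  shows "|\<Union>i\<in>I. A i| <o |C|"
proof -
  define B where "B = I <+> (Field \<tau> <+> (UNIV :: nat set))"
  have \<tau>: "|Field \<tau>| =o \<tau>"
    using assms(4) by (rule card_of_Field_ordIso)
  have B: "|B| <o |C|"
    unfolding B_def using assms \<tau>
    by (intro card_of_Plus_ordLess_infinite) (auto intro: ordIso_ordLess_trans)
  have \<tau>B: "\<tau> \<le>o |B|"
  proof -
    have "|Field \<tau>| \<le>o |B|"
      unfolding B_def using card_of_Plus1 card_of_Plus2 ordLeq_transitive by blast
    then show ?thesis
      using \<tau> ordIso_symmetric ordIso_ordLeq_trans by blast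
  qed
  have "|\<Union>i\<in>I. A i| \<le>o |B|"
  proof (rule card_of_UNION_ordLeq_infinite)
    show "infinite B"
      unfolding B_def by (simp add: finite_Plus_iff)
    show "|I| \<le>o |B|"
      unfolding B_def by (rule card_of_Plus1)
    show "\<forall>i\<in>I. |A i| \<le>o |B|"
      using assms(6) \<tau>B ordLeq_transitive by blast
  qed
  then show ?thesis
    using B ordLeq_ordLess_trans by blast
qed

lemma nat_less_continuum: "|UNIV :: nat set| <o continuum"
  using card_of_Pow[of "UNIV :: nat set"] by simp

lemma infinite_nat_set: "infinite (UNIV :: nat set set)"
  by (simp add: Finite_Set.finite_set)


section \<open>Images of complementary clopen sets along the system\<close>

lemma compact_space_directed_Inter:
  fixes C :: "'i::linorder \<Rightarrow> 'a set"
  assumes "compact_space X" "I \<noteq> {}" "\<And>i. i \<in> I \<Longrightarrow> closedin X (C i)" "\<And>i. i \<in> I \<Longrightarrow> C i \<noteq> {}"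
    and mono: "\<And>i j. i \<in> I \<Longrightarrow> j \<in> I \<Longrightarrow> i \<le> j \<Longrightarrow> C j \<subseteq> C i"
  shows "(\<Inter>i\<in>I. C i) \<noteq> {}"
proof -
  have "\<Inter>\<F> \<noteq> {}" if "finite \<F>" "\<F> \<subseteq> C ` I" for \<F>
  proof -
    obtain J where J: "J \<subseteq> I" "finite J" "\<F> = C ` J"
      using finite_subset_image[OF \<open>finite \<F>\<close> \<open>\<F> \<subseteq> C ` I\<close>] by auto
    show ?thesis
    proof (cases "J = {}")
      case False
      then have "Max J \<in> I"
        using J Max_in[of J] by blast
      moreover have "C (Max J) \<subseteq> \<Inter>\<F>"
      proof -
        have "C (Max J) \<subseteq> C j" if "j \<in> J" for j
          using mono[of j "Max J"] J \<open>Max J \<in> I\<close> Max_ge[OF J(2) that] that by blast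
        then show ?thesis
          using J(3) by blast
      qed
      ultimately show ?thesis
        using assms(4) by blast
    qed (use J in simp)
  qed
  moreover have "\<forall>D\<in>C ` I. closedin X D"
    using assms(3) by blast
  ultimately show ?thesis
    using assms(1)[unfolded compact_space_fip, rule_format, of "C ` I"] by simp
qed

context simple_extension_system
begin

lemma bonding_surj:
  assumes "\<alpha> \<le> \<beta>" "\<beta> \<le> \<delta>"
  shows "\<pi> \<alpha> \<beta> ` topspace (K \<beta>) = topspace (K \<alpha>)"
proof (cases "\<alpha> = \<beta>")
  case True
  then show ?thesis
    using bonding_id[of \<alpha>] assms by force
next
  case False
  then show ?thesis
    using irreducible[of \<alpha> \<beta>] assms by (simp add: irreducible_map_def)
qed

lemma bonding_in_topspace:
  assumes "\<alpha> \<le> \<beta>" "\<beta> \<le> \<delta>" "x \<in> topspace (K \<beta>)"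
  shows "\<pi> \<alpha> \<beta> x \<in> topspace (K \<alpha>)"
  using bonding_surj[OF assms(1,2)] assms(3) by blast

lemma closedin_bonding_image:
  assumes "\<alpha> \<le> \<beta>" "\<beta> \<le> \<delta>" "closedin (K \<beta>) C"
  shows "closedin (K \<alpha>) (\<pi> \<alpha> \<beta> ` C)"
proof -
  have "compactin (K \<beta>) C"
    using assms compact closedin_compact_space by blast
  then have "compactin (K \<alpha>) (\<pi> \<alpha> \<beta> ` C)"
    using continuous[OF assms(1,2)] image_compactin by blast
  then show ?thesis
    using Hausdorff assms compactin_imp_closedin by (metis order_trans)
qed

lemma bonding_image_comp:
  assumes "\<alpha> \<le> \<beta>" "\<beta> \<le> \<gamma>" "\<gamma> \<le> \<delta>" "A \<subseteq> topspace (K \<gamma>)"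
  shows "\<pi> \<alpha> \<beta> ` (\<pi> \<beta> \<gamma> ` A) = \<pi> \<alpha> \<gamma> ` A"
  unfolding image_image
proof (rule image_cong)
  show "\<pi> \<alpha> \<beta> (\<pi> \<beta> \<gamma> x) = \<pi> \<alpha> \<gamma> x" if "x \<in> A" for x
    using bonding_comp[OF assms(1-3)] assms(4) that by blast
qed simp

text \<open>A point over a thread of nonempty closed sets. As the bonding maps are surjective, this needs no
  passage through the product: the preimages in \<open>K \<gamma>\<close> form a chain of nonempty closed sets.
  The set \<open>C\<close> allows the point to be found inside a prescribed closed set.\<close>

lemma limit_nonempty:
  assumes "ord_limit \<gamma>" "\<gamma> \<le> \<delta>"
    and "\<And>\<alpha>. \<alpha> < \<gamma> \<Longrightarrow> closedin (K \<alpha>) (A \<alpha>)" "\<And>\<alpha>. \<alpha> < \<gamma> \<Longrightarrow> A \<alpha> \<noteq> {}"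
    and A_mono: "\<And>\<alpha> \<beta>. \<alpha> \<le> \<beta> \<Longrightarrow> \<beta> < \<gamma> \<Longrightarrow> \<pi> \<alpha> \<beta> ` A \<beta> \<subseteq> A \<alpha>"
    and "closedin (K \<gamma>) C" and C: "\<And>\<alpha>. \<alpha> < \<gamma> \<Longrightarrow> A \<alpha> \<subseteq> \<pi> \<alpha> \<gamma> ` C"
  obtains z where "z \<in> C" "\<And>\<alpha>. \<alpha> < \<gamma> \<Longrightarrow> \<pi> \<alpha> \<gamma> z \<in> A \<alpha>"
proof -
  have Csub: "C \<subseteq> topspace (K \<gamma>)"
    using assms(6) closedin_subset by blast
  have "ord_zero < \<gamma>"
    using assms(1) ord_zero_le[of \<gamma>] unfolding ord_limit_def by (metis order_le_less)
  have "(\<Inter>\<alpha>\<in>{..<\<gamma>}. C \<inter> {z \<in> topspace (K \<gamma>). \<pi> \<alpha> \<gamma> z \<in> A \<alpha>}) \<noteq> {}"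
  proof (rule compact_space_directed_Inter)
    show "compact_space (K \<gamma>)"
      using assms(2) by (rule compact)
    show "{..<\<gamma>} \<noteq> {}"
      using \<open>ord_zero < \<gamma>\<close>
      by auto
  next
    fix \<alpha> assume "\<alpha> \<in> {..<\<gamma>}"
    then have \<alpha>: "\<alpha> < \<gamma>" by simp
    show "closedin (K \<gamma>) (C \<inter> {z \<in> topspace (K \<gamma>). \<pi> \<alpha> \<gamma> z \<in> A \<alpha>})"
      using \<alpha> assms(2,3,6) continuous[of \<alpha> \<gamma>]
      by (intro closedin_Int closedin_continuous_map_preimage) auto
    show "C \<inter> {z \<in> topspace (K \<gamma>). \<pi> \<alpha> \<gamma> z \<in> A \<alpha>} \<noteq> {}"
      using C[OF \<alpha>] assms(4)[OF \<alpha>] Csub by blast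
  next
    fix \<alpha> \<beta> assume *: "\<alpha> \<in> {..<\<gamma>}" "\<beta> \<in> {..<\<gamma>}" "\<alpha> \<le> \<beta>"
    show "C \<inter> {z \<in> topspace (K \<gamma>). \<pi> \<beta> \<gamma> z \<in> A \<beta>} \<subseteq> C \<inter> {z \<in> topspace (K \<gamma>). \<pi> \<alpha> \<gamma> z \<in> A \<alpha>}"
    proof safe
      fix z assume z: "z \<in> topspace (K \<gamma>)" "\<pi> \<beta> \<gamma> z \<in> A \<beta>"
      have "\<pi> \<alpha> \<beta> (\<pi> \<beta> \<gamma> z) \<in> A \<alpha>"
        using A_mono[of \<alpha> \<beta>] z(2) * by auto
      then show "\<pi> \<alpha> \<gamma> z \<in> A \<alpha>"
        using bonding_comp[of \<alpha> \<beta> \<gamma> z] * z(1) assms(2) by simp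
    qed
  qed
  then obtain z where "z \<in> (\<Inter>\<alpha>\<in>{..<\<gamma>}. C \<inter> {z \<in> topspace (K \<gamma>). \<pi> \<alpha> \<gamma> z \<in> A \<alpha>})"
    by blast
  then have z: "z \<in> C \<and> \<pi> \<alpha> \<gamma> z \<in> A \<alpha>" if "\<alpha> < \<gamma>" for \<alpha>
    using INT_D[of z _ "{..<\<gamma>}" \<alpha>] that by blast
  then have "z \<in> C"
    using \<open>ord_zero < \<gamma>\<close> by blast
  with z show ?thesis
    using that by blast
qed

text \<open>A closed subset of a limit stage is determined by its images. By limit_nonempty some \<open>u \<in> C\<close>
  has the same coordinates as \<open>z\<close>, and points of a limit stage are separated by their coordinates.\<close>

lemma limit_closed:
  assumes "ord_limit \<gamma>" "\<gamma> \<le> \<delta>" "closedin (K \<gamma>) C" "z \<in> topspace (K \<gamma>)"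
    and z: "\<And>\<alpha>. \<alpha> < \<gamma> \<Longrightarrow> \<pi> \<alpha> \<gamma> z \<in> \<pi> \<alpha> \<gamma> ` C"
  shows "z \<in> C"
proof -
  obtain u where u: "u \<in> C" "\<And>\<alpha>. \<alpha> < \<gamma> \<Longrightarrow> \<pi> \<alpha> \<gamma> u \<in> {\<pi> \<alpha> \<gamma> z}"
  proof (rule limit_nonempty[OF assms(1,2), where A = "\<lambda>\<alpha>. {\<pi> \<alpha> \<gamma> z}" and C = C])
    fix \<alpha> assume \<alpha>: "\<alpha> < \<gamma>"
    then show "closedin (K \<alpha>) {\<pi> \<alpha> \<gamma> z}"
      using assms(2,4) bonding_in_topspace[of \<alpha> \<gamma> z] Hausdorff[of \<alpha>]
      by (simp add: closedin_Hausdorff_singleton)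
    show "{\<pi> \<alpha> \<gamma> z} \<subseteq> \<pi> \<alpha> \<gamma> ` C"
      using z[OF \<alpha>] by simp
    show "{\<pi> \<alpha> \<gamma> z} \<noteq> {}"
      by simp
  next
    fix \<alpha> \<beta> assume "\<alpha> \<le> \<beta>" "\<beta> < \<gamma>"
    then show "\<pi> \<alpha> \<beta> ` {\<pi> \<beta> \<gamma> z} \<subseteq> {\<pi> \<alpha> \<gamma> z}"
      using bonding_comp[of \<alpha> \<beta> \<gamma> z] assms(2,4) by simp
  qed (use assms(3) in auto)
  have "u \<in> topspace (K \<gamma>)"
    using u(1) assms(3) closedin_subset by blast
  moreover have "(\<lambda>\<alpha>\<in>{..<\<gamma>}. \<pi> \<alpha> \<gamma> u) = (\<lambda>\<alpha>\<in>{..<\<gamma>}. \<pi> \<alpha> \<gamma> z)"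
    using u(2) by (auto intro!: restrict_ext)
  ultimately have "u = z"
    using homeomorphic_imp_injective_map[OF limit[OF assms(1,2)]] assms(4)
    by (auto dest: inj_onD)
  then show ?thesis
    using u(1) by simp
qed

text \<open>For clopen \<open>U\<close> this measures how far stage \<open>\<alpha>\<close> is from deciding \<open>U\<close>: the overlap is empty
  exactly if \<open>U\<close> is the preimage of a clopen set of \<open>K \<alpha>\<close>. Below the top it coincides with the
  boundary of the image of \<open>U\<close>, by irreducibility, but unlike the boundary it is
  visibly compatible with the bonding maps.\<close>

definition overlap :: "'a set \<Rightarrow> 'i \<Rightarrow> 'a set" where
  "overlap U \<alpha> = \<pi> \<alpha> \<delta> ` U \<inter> \<pi> \<alpha> \<delta> ` (topspace (K \<delta>) - U)"

lemma closedin_overlap: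
  assumes "closedin (K \<delta>) U" "openin (K \<delta>) U" "\<alpha> \<le> \<delta>"
  shows "closedin (K \<alpha>) (overlap U \<alpha>)"
  unfolding overlap_def using assms
  by (intro closedin_Int closedin_bonding_image) auto

lemma overlap_image:
  assumes "U \<subseteq> topspace (K \<delta>)" "\<alpha> \<le> \<beta>" "\<beta> \<le> \<delta>"
  shows "\<pi> \<alpha> \<beta> ` overlap U \<beta> \<subseteq> overlap U \<alpha>"
  unfolding overlap_def
  using bonding_image_comp[OF assms(2,3) order_refl] assms(1) by blast

text \<open>No overlap disappears at a limit stage: the overlaps are the images of closed sets, and a point
  all of whose coordinates lie in the images of a closed set belongs to that set.\<close>

lemma limit_overlap:
  assumes "closedin (K \<delta>) U" "openin (K \<delta>) U" "ord_limit \<gamma>" "\<gamma> \<le> \<delta>"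
    and "\<And>\<alpha>. \<alpha> < \<gamma> \<Longrightarrow> closedin (K \<alpha>) (A \<alpha>)" "\<And>\<alpha>. \<alpha> < \<gamma> \<Longrightarrow> A \<alpha> \<noteq> {}"
    and "\<And>\<alpha> \<beta>. \<alpha> \<le> \<beta> \<Longrightarrow> \<beta> < \<gamma> \<Longrightarrow> \<pi> \<alpha> \<beta> ` A \<beta> \<subseteq> A \<alpha>"
    and A: "\<And>\<alpha>. \<alpha> < \<gamma> \<Longrightarrow> A \<alpha> \<subseteq> overlap U \<alpha>"
  obtains z where "z \<in> overlap U \<gamma>" "\<And>\<alpha>. \<alpha> < \<gamma> \<Longrightarrow> \<pi> \<alpha> \<gamma> z \<in> A \<alpha>"
proof -
  obtain z where z: "z \<in> topspace (K \<gamma>)" "\<And>\<alpha>. \<alpha> < \<gamma> \<Longrightarrow> \<pi> \<alpha> \<gamma> z \<in> A \<alpha>"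
  proof (rule limit_nonempty[OF assms(3,4,5,6,7), where C = "topspace (K \<gamma>)"])
    show "A \<alpha> \<subseteq> \<pi> \<alpha> \<gamma> ` topspace (K \<gamma>)" if "\<alpha> < \<gamma>" for \<alpha>
      using closedin_subset[OF assms(5)[OF that]] bonding_surj[of \<alpha> \<gamma>] assms(4) that by simp
  qed auto
  have "z \<in> \<pi> \<gamma> \<delta> ` V" if V: "closedin (K \<delta>) V" "\<And>\<alpha>. \<alpha> < \<gamma> \<Longrightarrow> \<pi> \<alpha> \<gamma> z \<in> \<pi> \<alpha> \<delta> ` V" for V
  proof (rule limit_closed[OF assms(3,4) _ z(1)])
    show "closedin (K \<gamma>) (\<pi> \<gamma> \<delta> ` V)"
      using V(1) assms(4) by (intro closedin_bonding_image) auto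
    show "\<pi> \<alpha> \<gamma> z \<in> \<pi> \<alpha> \<gamma> ` \<pi> \<gamma> \<delta> ` V" if "\<alpha> < \<gamma>" for \<alpha>
      using V(2)[OF that] bonding_image_comp[of \<alpha> \<gamma> \<delta> V] that assms(4) closedin_subset[OF V(1)] by simp
  qed
  then have "z \<in> overlap U \<gamma>"
    using z(2) A assms(1,2) unfolding overlap_def by blast
  then show ?thesis
    using z(2) that by blast
qed

text \<open>If the image of \<open>U\<close> contained a neighbourhood of a point \<open>x\<close> in the overlap, then the part \<open>V\<close> of
  the complement of \<open>U\<close> lying above this neighbourhood could be removed from \<open>K \<delta>\<close> without losing
  surjectivity, contradicting irreducibility.\<close>

lemma overlap_subset_frontier:
  assumes "closedin (K \<delta>) U" "openin (K \<delta>) U" "\<alpha> < \<delta>"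
  shows "overlap U \<alpha> \<subseteq> K \<alpha> frontier_of (\<pi> \<alpha> \<delta> ` U)"
proof
  let ?p = "\<pi> \<alpha> \<delta>" and ?T = "topspace (K \<delta>)"
  fix x assume x: "x \<in> overlap U \<alpha>"
  define O' where "O' = K \<alpha> interior_of (?p ` U)"
  have "closedin (K \<alpha>) (?p ` U)"
    using assms by (intro closedin_bonding_image) auto
  then have "x \<in> K \<alpha> closure_of (?p ` U)"
    using x by (simp add: overlap_def closure_of_closedin)
  moreover have "x \<notin> O'"
  proof
    assume "x \<in> O'"
    define V where "V = {y \<in> ?T. ?p y \<in> O'} - U"
    have "openin (K \<delta>) V"
      unfolding V_def O'_def using assms(1,3)
      by (intro openin_diff openin_continuous_map_preimage[OF continuous[of \<alpha> \<delta>]]) auto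
    then have "closedin (K \<delta>) (?T - V)"
      by blast
    moreover have "?p ` (?T - V) = topspace (K \<alpha>)"
    proof
      show "?p ` (?T - V) \<subseteq> topspace (K \<alpha>)"
        using bonding_in_topspace[of \<alpha> \<delta>] less_imp_le[OF assms(3)] by blast
      show "topspace (K \<alpha>) \<subseteq> ?p ` (?T - V)"
      proof
        fix y assume "y \<in> topspace (K \<alpha>)"
        show "y \<in> ?p ` (?T - V)"
        proof (cases "y \<in> O'")
          case True
          then have "y \<in> ?p ` U"
            unfolding O'_def using interior_of_subset by fast
          then show ?thesis
            using closedin_subset[OF assms(1)] by (auto simp: V_def)
        next
          case False
          then show ?thesis
            using bonding_surj[OF less_imp_le[OF assms(3)] order_refl] \<open>y \<in> topspace (K \<alpha>)\<close>
            by (auto simp: V_def)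
        qed
      qed
    qed
    ultimately have "?T - V = ?T"
      using irreducible[OF assms(3) order_refl] unfolding irreducible_map_def by metis
    moreover have "V \<noteq> {}" "V \<subseteq> ?T"
      using x \<open>x \<in> O'\<close> by (auto simp: V_def overlap_def)
    ultimately show False
      by blast
  qed
  ultimately show "x \<in> K \<alpha> frontier_of (?p ` U)"
    by (simp add: frontier_of_def O'_def)
qed

lemma frontier_subset_overlap:
  assumes "closedin (K \<delta>) U" "openin (K \<delta>) U" "\<alpha> \<le> \<delta>"
  shows "K \<alpha> frontier_of (\<pi> \<alpha> \<delta> ` U) \<subseteq> overlap U \<alpha>"
proof -
  let ?A = "\<pi> \<alpha> \<delta> ` U" and ?B = "\<pi> \<alpha> \<delta> ` (topspace (K \<delta>) - U)"
  have cl: "closedin (K \<alpha>) ?A" "closedin (K \<alpha>) ?B"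
    using assms by (auto intro!: closedin_bonding_image)
  have "topspace (K \<alpha>) - ?A \<subseteq> ?B"
    using bonding_surj[OF assms(3) order_refl] by blast
  then have "K \<alpha> closure_of (topspace (K \<alpha>) - ?A) \<subseteq> ?B"
    using cl(2) by (rule closure_of_minimal)
  then show ?thesis
    using cl(1) by (auto simp: overlap_def frontier_of_closures closure_of_closedin)
qed

text \<open>The only place where the defining property of a simple extension enters; it is applied
  to the closed set \<open>\<pi> (ord_succ \<alpha>) \<delta> ` U\<close>, which in general is not clopen.\<close>

lemma overlap_successor:
  assumes "closedin (K \<delta>) U" "openin (K \<delta>) U" "\<alpha> < \<delta>"
  shows "|overlap U \<alpha> - \<pi> \<alpha> (ord_succ \<alpha>) ` overlap U (ord_succ \<alpha>)| \<le>o \<tau>"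
proof -
  let ?s = "ord_succ \<alpha>"
  have s: "\<alpha> \<le> ?s" "?s \<le> \<delta>"
    using ord_succ_props[OF assms(3)] by auto
  have im: "\<pi> \<alpha> ?s ` \<pi> ?s \<delta> ` U = \<pi> \<alpha> \<delta> ` U"
    using s assms(1) closedin_subset by (intro bonding_image_comp) auto
  have "closedin (K ?s) (\<pi> ?s \<delta> ` U)"
    using s assms(1) by (intro closedin_bonding_image) auto
  then have "|K \<alpha> frontier_of (\<pi> \<alpha> \<delta> ` U) - \<pi> \<alpha> ?s ` (K ?s frontier_of (\<pi> ?s \<delta> ` U))| \<le>o \<tau>"
    using simple[OF assms(3)] im unfolding simple_extension_def by metis
  moreover have "overlap U \<alpha> - \<pi> \<alpha> ?s ` overlap U ?s
      \<subseteq> K \<alpha> frontier_of (\<pi> \<alpha> \<delta> ` U) - \<pi> \<alpha> ?s ` (K ?s frontier_of (\<pi> ?s \<delta> ` U))"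
    using overlap_subset_frontier[OF assms] frontier_subset_overlap[OF assms(1,2) s(2)] by blast
  ultimately show ?thesis
    using card_of_mono1 ordLeq_transitive by blast
qed

lemma overlap_top: "U \<subseteq> topspace (K \<delta>) \<Longrightarrow> overlap U \<delta> = {}"
  unfolding overlap_def using bonding_id[OF order_refl] by (auto simp: subset_iff)

text \<open>Follow the part \<open>A \<alpha>\<close> of the overlap lying above \<open>x\<close> until it becomes empty. The first stage where
  this happens is neither the bottom nor a limit, so it is the successor of some \<open>\<zeta>\<close>, and \<open>x\<close> is the
  image of a point that the step from \<open>\<zeta>\<close> to its successor removes from the overlap.\<close>

lemma overlap_zero_origin:
  assumes U: "closedin (K \<delta>) U" "openin (K \<delta>) U"
    and \<beta>: "\<beta> \<le> \<delta>" "overlap U \<beta> = {}" and x: "x \<in> overlap U ord_zero"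
  obtains \<zeta> where "\<zeta> < \<beta>"
    "x \<in> \<pi> ord_zero \<zeta> ` (overlap U \<zeta> - \<pi> \<zeta> (ord_succ \<zeta>) ` overlap U (ord_succ \<zeta>))"
proof -
  have Usub: "U \<subseteq> topspace (K \<delta>)"
    using U closedin_subset by blast
  have ov_sub: "overlap U \<alpha> \<subseteq> topspace (K \<alpha>)" if "\<alpha> \<le> \<delta>" for \<alpha>
    using closedin_overlap[OF U that] closedin_subset by blast
  have x_top: "x \<in> topspace (K ord_zero)"
    using x ov_sub ord_zero_le by blast
  define A where "A \<alpha> = {y \<in> overlap U \<alpha>. \<pi> ord_zero \<alpha> y = x}" for \<alpha>
  have A_closed: "closedin (K \<alpha>) (A \<alpha>)" if "\<alpha> \<le> \<delta>" for \<alpha>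
  proof -
    have "A \<alpha> = overlap U \<alpha> \<inter> {y \<in> topspace (K \<alpha>). \<pi> ord_zero \<alpha> y \<in> {x}}"
      using ov_sub[OF that] by (auto simp: A_def)
    moreover have "closedin (K ord_zero) {x}"
      using Hausdorff[OF ord_zero_le] x_top by (rule closedin_Hausdorff_singleton)
    from closedin_continuous_map_preimage[OF continuous[OF ord_zero_le that] this]
    have "closedin (K \<alpha>) (overlap U \<alpha> \<inter> {y \<in> topspace (K \<alpha>). \<pi> ord_zero \<alpha> y \<in> {x}})"
      by (rule closedin_Int[OF closedin_overlap[OF U that]])
    ultimately show ?thesis
      by simp
  qed
  have A_image: "\<pi> \<alpha> \<gamma> y \<in> A \<alpha>" if "\<alpha> \<le> \<gamma>" "\<gamma> \<le> \<delta>" "y \<in> A \<gamma>" for \<alpha> \<gamma> y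
  proof -
    have y: "y \<in> overlap U \<gamma>" "\<pi> ord_zero \<gamma> y = x"
      using that(3) by (auto simp: A_def)
    then have "\<pi> \<alpha> \<gamma> y \<in> overlap U \<alpha>"
      using overlap_image[OF Usub that(1,2)] by blast
    moreover have "\<pi> ord_zero \<alpha> (\<pi> \<alpha> \<gamma> y) = x"
      using bonding_comp[OF ord_zero_le that(1,2)] ov_sub[OF that(2)] y by blast
    ultimately show ?thesis
      by (simp add: A_def)
  qed
  define \<alpha> where "\<alpha> = (LEAST \<alpha>. A \<alpha> = {})"
  have "A \<beta> = {}"
    using \<beta>(2) by (simp add: A_def)
  then have empty: "A \<alpha> = {}" and "\<alpha> \<le> \<beta>"
    unfolding \<alpha>_def by (rule LeastI, rule Least_le)
  have nonempty: "A \<gamma> \<noteq> {}" if "\<gamma> < \<alpha>" for \<gamma>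
    using not_less_Least that unfolding \<alpha>_def by blast
  have "\<alpha> \<le> \<delta>"
    using \<open>\<alpha> \<le> \<beta>\<close> \<beta>(1) by simp
  show ?thesis
  proof (cases \<alpha> rule: ord_cases)
    case 1
    then have "x \<in> A \<alpha>"
      using x x_top bonding_id[of ord_zero] ord_zero_le by (auto simp: A_def)
    then show ?thesis
      using empty by simp
  next
    case 2
    then obtain z where z: "z \<in> overlap U \<alpha>" "\<And>\<gamma>. \<gamma> < \<alpha> \<Longrightarrow> \<pi> \<gamma> \<alpha> z \<in> A \<gamma>"
    proof (rule limit_overlap[OF U _ \<open>\<alpha> \<le> \<delta>\<close>, where A = A])
      show "closedin (K \<gamma>) (A \<gamma>)" if "\<gamma> < \<alpha>" for \<gamma>
        using A_closed \<open>\<alpha> \<le> \<delta>\<close> that by simp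
      show "\<pi> \<gamma> \<gamma>' ` A \<gamma>' \<subseteq> A \<gamma>" if "\<gamma> \<le> \<gamma>'" "\<gamma>' < \<alpha>" for \<gamma> \<gamma>'
        using A_image[of \<gamma> \<gamma>'] that \<open>\<alpha> \<le> \<delta>\<close> by auto
      show "A \<gamma> \<subseteq> overlap U \<gamma>" for \<gamma>
        by (auto simp: A_def)
    qed (use nonempty in auto)
    have "ord_zero < \<alpha>"
      using 2 ord_zero_le[of \<alpha>] by (auto simp: ord_limit_def order_le_less)
    then have "\<pi> ord_zero \<alpha> z = x"
      using z ov_sub[OF \<open>\<alpha> \<le> \<delta>\<close>] z(2)[of ord_zero] bonding_comp[of ord_zero ord_zero \<alpha> z] \<open>\<alpha> \<le> \<delta>\<close>
      by (auto simp: A_def)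
    then have "z \<in> A \<alpha>"
      using z(1) by (simp add: A_def)
    then show ?thesis
      using empty by simp
  next
    case (3 \<zeta>)
    then obtain y where y: "y \<in> A \<zeta>"
      using nonempty by blast
    have "y \<notin> \<pi> \<zeta> \<alpha> ` overlap U \<alpha>"
    proof
      assume "y \<in> \<pi> \<zeta> \<alpha> ` overlap U \<alpha>"
      then obtain v where v: "v \<in> overlap U \<alpha>" "y = \<pi> \<zeta> \<alpha> v"
        by blast
      then have "\<pi> ord_zero \<alpha> v = x"
        using y bonding_comp[OF ord_zero_le _ \<open>\<alpha> \<le> \<delta>\<close>, of \<zeta> v] 3 ov_sub[OF \<open>\<alpha> \<le> \<delta>\<close>]
        by (auto simp: A_def)
      then have "v \<in> A \<alpha>"
        using v(1) by (simp add: A_def)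
      then show False
        using empty by simp
    qed
    then show ?thesis
      using that[of \<zeta>] 3 y \<open>\<alpha> \<le> \<beta>\<close> by (auto simp: A_def)
  qed
qed

text \<open>Every point of the overlap at the bottom is charged to a step at which at most \<open>\<tau>\<close> points leave
  the overlap. It remains to see that there are fewer than continuum many relevant steps even if
  \<open>\<delta>\<close> has the length of the continuum: the first stage \<open>\<beta>\<close> with empty overlap is not a limit, so only
  the steps up to the predecessor of \<open>\<beta>\<close> count, and this predecessor lies strictly below \<open>\<delta>\<close>.\<close>

lemma card_overlap_zero:
  assumes U: "closedin (K \<delta>) U" "openin (K \<delta>) U"
    and \<tau>: "Card_order \<tau>" "\<tau> <o continuum" and \<delta>: "ordinal_of \<delta> \<le>o continuum"
  shows "|overlap U ord_zero| <o continuum"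
proof -
  have Usub: "U \<subseteq> topspace (K \<delta>)"
    using U closedin_subset by blast
  define \<beta> where "\<beta> = (LEAST \<beta>. overlap U \<beta> = {})"
  have \<beta>: "overlap U \<beta> = {}" "\<beta> \<le> \<delta>"
    unfolding \<beta>_def using overlap_top[OF Usub] by (rule LeastI, rule Least_le)
  have nonempty: "overlap U \<alpha> \<noteq> {}" if "\<alpha> < \<beta>" for \<alpha>
    using not_less_Least that unfolding \<beta>_def by blast
  show ?thesis
  proof (cases \<beta> rule: ord_cases)
    case 1
    then show ?thesis
      using \<beta>(1) infinite_nat_set by (simp add: card_of_finite_less_infinite)
  next
    case 2
    then obtain z where "z \<in> overlap U \<beta>"
    proof (rule limit_overlap[OF U _ \<beta>(2), where A = "overlap U"])
      show "closedin (K \<gamma>) (overlap U \<gamma>)" if "\<gamma> < \<beta>" for \<gamma>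
        using closedin_overlap[OF U] \<beta>(2) that by simp
      show "\<pi> \<gamma> \<gamma>' ` overlap U \<gamma>' \<subseteq> overlap U \<gamma>" if "\<gamma> \<le> \<gamma>'" "\<gamma>' < \<beta>" for \<gamma> \<gamma>'
        using overlap_image[OF Usub, of \<gamma> \<gamma>'] that \<beta>(2) by auto
    qed (use nonempty in auto)
    then show ?thesis
      using \<beta>(1) by simp
  next
    case (3 \<eta>)
    let ?D = "\<lambda>\<zeta>. overlap U \<zeta> - \<pi> \<zeta> (ord_succ \<zeta>) ` overlap U (ord_succ \<zeta>)"
    have "overlap U ord_zero \<subseteq> (\<Union>\<zeta>\<in>{..\<eta>}. \<pi> ord_zero \<zeta> ` ?D \<zeta>)"
    proof
      fix x assume "x \<in> overlap U ord_zero"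
      then obtain \<zeta> where \<zeta>: "\<zeta> < \<beta>" "x \<in> \<pi> ord_zero \<zeta> ` ?D \<zeta>"
        using overlap_zero_origin[OF U \<beta>(2,1)] by blast
      have "\<zeta> \<le> \<eta>"
        using \<zeta>(1) 3(2) ord_succ_le[of \<eta> \<zeta>] by (meson leD leI)
      then show "x \<in> (\<Union>\<zeta>\<in>{..\<eta>}. \<pi> ord_zero \<zeta> ` ?D \<zeta>)"
        using \<zeta>(2) by blast
    qed
    moreover have "|\<Union>\<zeta>\<in>{..\<eta>}. \<pi> ord_zero \<zeta> ` ?D \<zeta>| <o continuum"
    proof (rule card_of_UN_less_uniform[OF infinite_nat_set nat_less_continuum _ \<tau>])
      show "|{..\<eta>}| <o continuum"
        using 3 \<beta>(2) \<delta> infinite_nat_set by (intro card_of_atMost_less[of \<eta> \<delta>]) auto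
      show "|\<pi> ord_zero \<zeta> ` ?D \<zeta>| \<le>o \<tau>" if "\<zeta> \<in> {..\<eta>}" for \<zeta>
      proof -
        have "\<zeta> < \<delta>"
          using that 3 \<beta>(2) by auto
        then show ?thesis
          using overlap_successor[OF U] card_of_image ordLeq_transitive by blast
      qed
    qed
    ultimately show ?thesis
      using card_of_mono1 ordLeq_ordLess_trans by blast
  qed
qed

end


section \<open>Cylinders of the Cantor space\<close>

lemma topspace_cantor [simp]: "topspace cantor_space = UNIV"
  by (simp add: cantor_space_def)

lemma compact_cantor: "compact_space cantor_space"
  by (simp add: cantor_space_def compact_space_product_topology compact_space_discrete_topology)

lemma Hausdorff_cantor: "Hausdorff_space cantor_space"
  by (simp add: cantor_space_def Hausdorff_space_product_topology)

text \<open>The first \<open>n\<close> digits of \<open>x\<close>, coded as a subset of \<open>{..<n}\<close>. Thus the \<open>2 ^ n\<close> cylinders of level \<open>n\<close>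
  are the fibres of \<open>ones_below n\<close>, and \<open>ones_below n ` A\<close> is the set of those that meet \<open>A\<close>.\<close>

definition ones_below :: "nat \<Rightarrow> (nat \<Rightarrow> bool) \<Rightarrow> nat set" where
  "ones_below n x = {i. i < n \<and> x i}"

lemma ones_below_Int: "m \<le> n \<Longrightarrow> ones_below m x = ones_below n x \<inter> {..<m}"
  by (auto simp: ones_below_def)

lemma ones_below_mono: "ones_below n x = ones_below n y \<Longrightarrow> m \<le> n \<Longrightarrow> ones_below m x = ones_below m y"
  by (simp add: ones_below_Int)

lemma ones_below_subset: "ones_below n x \<in> Pow {..<n}"
  by (auto simp: ones_below_def)

lemma finite_ones_below_image [simp]: "finite (ones_below n ` A)"
  by (rule finite_subset[of _ "Pow {..<n}"]) (auto simp: ones_below_def)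

lemma openin_cylinder: "openin cantor_space {y. ones_below n y = S}"
proof -
  let ?U = "\<lambda>i. if i < n then {i \<in> S} else UNIV"
  have "{y. ones_below n y = S} = (if S \<subseteq> {..<n} then PiE UNIV ?U else {})"
    by (auto simp: ones_below_def PiE_iff split: if_splits)
  moreover have "openin cantor_space (PiE UNIV ?U)"
  proof -
    have "finite {i. ?U i \<noteq> UNIV}"
      by (rule finite_subset[of _ "{..<n}"]) auto
    then show ?thesis
      unfolding cantor_space_def openin_PiE_gen by auto
  qed
  ultimately show ?thesis
    by simp
qed

lemma closedin_cylinders: "closedin cantor_space {y. ones_below n y \<in> T}"
proof -
  have "openin cantor_space (\<Union>S\<in>-T. {y. ones_below n y = S})"
    using openin_cylinder by blast
  moreover have "(\<Union>S\<in>-T. {y. ones_below n y = S}) = topspace cantor_space - {y. ones_below n y \<in> T}"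
    by auto
  ultimately show ?thesis
    by (simp add: closedin_def)
qed

lemma cylinder_base:
  assumes "openin cantor_space U" "x \<in> U"
  obtains n where "{y. ones_below n y = ones_below n x} \<subseteq> U"
proof -
  obtain V where V: "finite {i. V i \<noteq> UNIV}" "x \<in> PiE UNIV V" "PiE UNIV V \<subseteq> U"
    using assms unfolding cantor_space_def openin_product_topology_alt by auto
  obtain n where n: "{i. V i \<noteq> UNIV} \<subseteq> {..<n}"
    using V(1) finite_nat_iff_bounded by blast
  have "{y. ones_below n y = ones_below n x} \<subseteq> PiE UNIV V"
  proof
    fix y assume "y \<in> {y. ones_below n y = ones_below n x}"
    then have "y i = x i" if "i < n" for i
      using that by (auto simp: ones_below_def set_eq_iff)
    then have "y i \<in> V i" for i
      using n V(2) by (cases "i < n") (auto simp: PiE_iff)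
    then show "y \<in> PiE UNIV V"
      by (simp add: PiE_iff)
  qed
  then have "{y. ones_below n y = ones_below n x} \<subseteq> U"
    using V(3) by (rule order_trans)
  then show ?thesis
    by (rule that)
qed

lemma card_extensions:
  assumes "m \<le> n" "finite T"
  shows "card {S \<in> Pow {..<n}. S \<inter> {..<m} \<in> T} \<le> card T * 2 ^ (n - m)"
proof -
  have "{S \<in> Pow {..<n}. S \<inter> {..<m} \<in> T} \<subseteq> (\<lambda>(R, Q). R \<union> Q) ` (T \<times> Pow {m..<n})"
  proof
    fix S assume S: "S \<in> {S \<in> Pow {..<n}. S \<inter> {..<m} \<in> T}"
    then have "S = S \<inter> {..<m} \<union> S \<inter> {m..<n}"
      by auto
    then show "S \<in> (\<lambda>(R, Q). R \<union> Q) ` (T \<times> Pow {m..<n})"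
      using S by (intro image_eqI[of _ _ "(S \<inter> {..<m}, S \<inter> {m..<n})"]) auto
  qed
  then have "card {S \<in> Pow {..<n}. S \<inter> {..<m} \<in> T} \<le> card (T \<times> Pow {m..<n})"
    using assms(2) by (intro surj_card_le) auto
  then show ?thesis
    by (simp add: card_cartesian_product card_Pow)
qed

lemma closedin_cantor_finite_subcover:
  assumes "closedin cantor_space C"
    and "\<And>x. x \<in> C \<Longrightarrow> \<exists>i\<in>I. x \<in> U i" and "\<And>i. i \<in> I \<Longrightarrow> openin cantor_space (U i)"
  obtains J where "J \<subseteq> I" "finite J" "C \<subseteq> (\<Union>i\<in>J. U i)"
proof -
  have "compactin cantor_space C"
    using compact_cantor assms(1) by (rule closedin_compact_space)
  then obtain \<F> where \<F>: "finite \<F>" "\<F> \<subseteq> U ` I" "C \<subseteq> \<Union>\<F>"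
  proof (rule compactinD[where \<U> = "U ` I", THEN exE])
    show "C \<subseteq> \<Union>(U ` I)"
      using assms(2) by blast
  qed (use assms(3) in auto)
  then obtain J where "J \<subseteq> I" "finite J" "\<F> = U ` J"
    using finite_subset_image by metis
  with \<F>(3) show ?thesis
    by (intro that) auto
qed

text \<open>Two disjoint closed sets have positive distance, so no sufficiently short cylinder meets both.\<close>

lemma closed_disjoint_cylinders:
  assumes "closedin cantor_space A" "closedin cantor_space B" "A \<inter> B = {}"
  obtains n\<^sub>0 where "\<And>n. n \<ge> n\<^sub>0 \<Longrightarrow> ones_below n ` A \<inter> ones_below n ` B = {}"
proof -
  define I where "I = {(a, n). a \<in> A \<and> (\<forall>b\<in>B. ones_below n b \<noteq> ones_below n a)}"
  have "\<exists>n. (a, n) \<in> I" if "a \<in> A" for a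
  proof -
    have "openin cantor_space (UNIV - B)" "a \<in> UNIV - B"
      using assms that by (auto simp: closedin_def)
    then obtain n where "{y. ones_below n y = ones_below n a} \<subseteq> UNIV - B"
      by (rule cylinder_base)
    then show ?thesis
      using that unfolding I_def by blast
  qed
  then have "\<exists>i\<in>I. a \<in> (case i of (x, n) \<Rightarrow> {y. ones_below n y = ones_below n x})" if "a \<in> A" for a
    using that by force
  then obtain J where J: "J \<subseteq> I" "finite J" "A \<subseteq> (\<Union>i\<in>J. case i of (x, n) \<Rightarrow> {y. ones_below n y = ones_below n x})"
    by (rule closedin_cantor_finite_subcover[OF assms(1)]) (auto simp: openin_cylinder)
  obtain n\<^sub>0 where n\<^sub>0: "\<And>i. i \<in> J \<Longrightarrow> snd i \<le> n\<^sub>0"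
    using J(2) finite_nat_set_iff_bounded_le[of "snd ` J"] by auto
  show ?thesis
  proof (rule that, rule ccontr)
    fix n assume "n\<^sub>0 \<le> n" "ones_below n ` A \<inter> ones_below n ` B \<noteq> {}"
    then obtain a b where ab: "a \<in> A" "b \<in> B" "ones_below n a = ones_below n b"
      by auto
    then obtain x m where xm: "(x, m) \<in> J" "ones_below m a = ones_below m x"
      using J(3) by fastforce
    then have "m \<le> n"
      using n\<^sub>0[OF xm(1)] \<open>n\<^sub>0 \<le> n\<close> by simp
    then have "ones_below m b = ones_below m x"
      using xm(2) ones_below_mono[OF ab(3)] by simp
    then show False
      using xm(1) J(1) ab(2) by (auto simp: I_def)
  qed
qed

text \<open>The perfect set theorem: the condensation points of an uncountable closed set form a nonempty
  perfect set, which has the cardinality of the continuum.\<close>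

lemma small_closed_cantor_countable:
  assumes "closedin cantor_space C" "|C| <o continuum"
  shows "countable C"
proof (rule ccontr)
  assume unc: "uncountable C"
  define cyl where "cyl n S = {y. ones_below n y = S}" for n S
  define P where "P = {x \<in> C. \<forall>n. uncountable (C \<inter> cyl n (ones_below n x))}"
  have "C - P \<subseteq> (\<Union>n. \<Union>S\<in>{S \<in> Pow {..<n}. countable (C \<inter> cyl n S)}. C \<inter> cyl n S)"
    using ones_below_subset by (fastforce simp: P_def cyl_def)
  moreover have "countable (\<Union>n. \<Union>S\<in>{S \<in> Pow {..<n}. countable (C \<inter> cyl n S)}. C \<inter> cyl n S)"
    by (intro countable_UN) (auto intro: countable_finite)
  ultimately have CP: "countable (C - P)"
    using countable_subset by blast
  have "P \<subseteq> C"
    by (auto simp: P_def)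
  have "P \<noteq> {}"
    using CP unc by auto
  have "cantor_space derived_set_of P \<subseteq> P"
  proof
    fix x assume x: "x \<in> cantor_space derived_set_of P"
    have "\<exists>y\<in>P. ones_below n y = ones_below n x" for n
    proof -
      have "\<exists>y. y \<noteq> x \<and> y \<in> P \<and> y \<in> {y. ones_below n y = ones_below n x}"
        using x openin_cylinder[of n "ones_below n x"] by (auto simp: in_derived_set_of)
      then show ?thesis
        by blast
    qed
    then have "uncountable (C \<inter> cyl n (ones_below n x))" for n
      unfolding P_def by (metis (mono_tags, lifting) mem_Collect_eq)
    moreover have "cantor_space derived_set_of P \<subseteq> C"
      using assms(1) derived_set_of_mono[OF \<open>P \<subseteq> C\<close>, of cantor_space]
      unfolding closedin_contains_derived_set by (meson order_trans)
    ultimately show "x \<in> P"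
      using x by (auto simp: P_def)
  qed
  moreover have "P \<subseteq> cantor_space derived_set_of P"
  proof
    fix x assume x: "x \<in> P"
    have "\<exists>y\<noteq>x. y \<in> P \<and> y \<in> U" if U: "x \<in> U" "openin cantor_space U" for U
    proof -
      obtain n where n: "{y. ones_below n y = ones_below n x} \<subseteq> U"
        using cylinder_base[OF U(2,1)] by blast
      have "uncountable (C \<inter> cyl n (ones_below n x))"
        using x by (simp add: P_def)
      moreover have "countable (insert x (C - P))"
        using CP by simp
      ultimately have "\<not> C \<inter> cyl n (ones_below n x) \<subseteq> insert x (C - P)"
        using countable_subset by blast
      then show ?thesis
        using n by (auto simp: cyl_def)
    qed
    then show "x \<in> cantor_space derived_set_of P"
      by (simp add: in_derived_set_of)
  qed
  ultimately have "(UNIV :: real set) \<lesssim> P"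
    using \<open>P \<noteq> {}\<close> compact_imp_locally_compact_space[OF compact_cantor] Hausdorff_cantor
    by (intro lepoll_perfect_set) auto
  then have "(UNIV :: nat set set) \<lesssim> C"
    using nat_sets_eqpoll_reals \<open>P \<subseteq> C\<close> lepoll_trans lepoll_trans2 subset_imp_lepoll eqpoll_imp_lepoll by metis
  then have "continuum \<le>o |C|"
    unfolding lepoll_def using card_of_ordLeq by blast
  then show False
    using assms(2) not_ordLess_ordLeq by blast
qed

text \<open>Cover the \<open>i\<close>-th point of the set by a cylinder of measure \<open>2 powr - (i + Suc k)\<close>. By compactness
  finitely many of these cylinders suffice, so they can be counted at one common level \<open>m\<close>.\<close>

lemma countable_closed_null:
  assumes "closedin cantor_space C" "countable C" "0 < \<epsilon>"
  obtains m where "real (card (ones_below m ` C)) \<le> \<epsilon> * 2 ^ m"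
proof (cases "C = {}")
  case True
  then show ?thesis
    using that[of 0] assms(3) by simp
next
  case False
  define c where "c = from_nat_into C"
  have c: "C = range c"
    unfolding c_def using range_from_nat_into[OF False assms(2)] by simp
  obtain k where k: "(1/2 :: real) ^ k < \<epsilon>"
    using real_arch_pow_inv[OF assms(3), of "1/2"] by auto
  let ?l = "\<lambda>i. i + Suc k"
  obtain J where J: "finite J" "C \<subseteq> (\<Union>i\<in>J. {y. ones_below (?l i) y = ones_below (?l i) (c i)})"
    by (rule closedin_cantor_finite_subcover[OF assms(1), of UNIV "\<lambda>i. {y. ones_below (?l i) y = ones_below (?l i) (c i)}"])
      (auto simp: c openin_cylinder)
  obtain m\<^sub>0 where m\<^sub>0: "\<And>i. i \<in> J \<Longrightarrow> i < m\<^sub>0"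
    using J(1) finite_nat_iff_bounded by (metis lessThan_iff subsetD)
  let ?m = "?l m\<^sub>0"
  let ?E = "\<lambda>i. {S \<in> Pow {..<?m}. S \<inter> {..<?l i} \<in> {ones_below (?l i) (c i)}}"
  have E: "real (card (?E i)) \<le> (1/2) ^ k * 2 ^ ?m * (1/2) ^ Suc i" if "i \<in> J" for i
  proof -
    have "card (?E i) \<le> 1 * 2 ^ (?m - ?l i)"
      using card_extensions[of "?l i" ?m "{ones_below (?l i) (c i)}"] m\<^sub>0[OF that] by simp
    then have "real (card (?E i)) \<le> real (1 * 2 ^ (?m - ?l i))"
      by (rule of_nat_mono)
    also have "\<dots> = (2 :: real) ^ (m\<^sub>0 - i)"
      by simp
    also have "\<dots> = 2 ^ m\<^sub>0 / 2 ^ i"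
      using m\<^sub>0[OF that] by (simp add: power_diff)
    also have "\<dots> = (1/2) ^ k * 2 ^ ?m * (1/2) ^ Suc i"
      by (simp add: power_add power_divide)
    finally show ?thesis .
  qed
  have "ones_below ?m ` C \<subseteq> (\<Union>i\<in>J. ?E i)"
  proof
    fix S assume "S \<in> ones_below ?m ` C"
    then obtain y where y: "y \<in> C" "S = ones_below ?m y" by blast
    then obtain i where i: "i \<in> J" "ones_below (?l i) y = ones_below (?l i) (c i)"
      using J(2) by blast
    then have "ones_below ?m y \<in> ?E i"
      using ones_below_Int[of "?l i" ?m y] ones_below_subset m\<^sub>0[OF i(1)] by auto
    then show "S \<in> (\<Union>i\<in>J. ?E i)"
      using i(1) y(2) by blast
  qed
  then have "card (ones_below ?m ` C) \<le> card (\<Union>i\<in>J. ?E i)"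
    using J(1) by (intro card_mono) auto
  also have "\<dots> \<le> (\<Sum>i\<in>J. card (?E i))"
    using J(1) by (rule card_UN_le)
  finally have "real (card (ones_below ?m ` C)) \<le> real (\<Sum>i\<in>J. card (?E i))"
    by (rule of_nat_mono)
  also have "\<dots> = (\<Sum>i\<in>J. real (card (?E i)))"
    by simp
  also have "\<dots> \<le> (\<Sum>i\<in>J. (1/2) ^ k * 2 ^ ?m * (1/2) ^ Suc i)"
    by (intro sum_mono E)
  also have "\<dots> = (1/2) ^ k * 2 ^ ?m * (\<Sum>i\<in>J. (1/2) ^ Suc i)"
    by (simp add: sum_distrib_left)
  also have "\<dots> \<le> (1/2) ^ k * 2 ^ ?m * 1"
  proof (rule mult_left_mono)
    show "(\<Sum>i\<in>J. (1/2 :: real) ^ Suc i) \<le> 1"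
      using sum_le_suminf[OF sums_summable[OF power_half_series] J(1)] sums_unique[OF power_half_series] by simp
  qed simp
  also have "\<dots> \<le> \<epsilon> * 2 ^ ?m"
    using k by simp
  finally show ?thesis
    by (rule that)
qed

text \<open>Almost every cylinder is decided between \<open>A\<close> and \<open>B\<close>. The intersection \<open>A \<inter> B\<close> is countable, so for
  some \<open>m\<close> it meets only a small proportion of the cylinders of level \<open>m\<close>; outside these the two sets
  are disjoint and closed, so no short cylinder meets both.\<close>

lemma common_cylinders_density:
  assumes "closedin cantor_space A" "closedin cantor_space B" "|A \<inter> B| <o continuum"
  shows "(\<lambda>n. real (card (ones_below n ` A \<inter> ones_below n ` B)) / 2 ^ n) \<longlonglongrightarrow> 0"
proof (rule LIMSEQ_I)
  fix r :: real assume "0 < r"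
  have C: "closedin cantor_space (A \<inter> B)"
    using assms by blast
  obtain m where m: "real (card (ones_below m ` (A \<inter> B))) \<le> r / 2 * 2 ^ m"
    using countable_closed_null[OF C small_closed_cantor_countable[OF C assms(3)], of "r / 2"] \<open>0 < r\<close>
    by auto
  let ?T = "ones_below m ` (A \<inter> B)"
  obtain n\<^sub>0 where n\<^sub>0: "\<And>n. n \<ge> n\<^sub>0 \<Longrightarrow> ones_below n ` (A \<inter> {y. ones_below m y \<in> - ?T}) \<inter> ones_below n ` B = {}"
  proof (rule closed_disjoint_cylinders)
    show "closedin cantor_space (A \<inter> {y. ones_below m y \<in> - ?T})"
      using assms(1) closedin_cylinders by blast
  qed (use assms(2) in auto)
  show "\<exists>N. \<forall>n\<ge>N. norm (real (card (ones_below n ` A \<inter> ones_below n ` B)) / 2 ^ n - 0) < r"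
  proof (intro exI allI impI)
    fix n assume n: "max m n\<^sub>0 \<le> n"
    have "ones_below n ` A \<inter> ones_below n ` B \<subseteq> {S \<in> Pow {..<n}. S \<inter> {..<m} \<in> ?T}"
    proof
      fix S assume S: "S \<in> ones_below n ` A \<inter> ones_below n ` B"
      then obtain a where a: "a \<in> A" "S = ones_below n a" by blast
      have "ones_below m a \<in> ?T"
        using n\<^sub>0[of n] n a S by (metis (no_types, lifting) Compl_iff IntI empty_iff image_eqI max.bounded_iff mem_Collect_eq Int_iff)
      then show "S \<in> {S \<in> Pow {..<n}. S \<inter> {..<m} \<in> ?T}"
        using a(2) ones_below_subset ones_below_Int[of m n a] n by simp
    qed
    then have "card (ones_below n ` A \<inter> ones_below n ` B) \<le> card {S \<in> Pow {..<n}. S \<inter> {..<m} \<in> ?T}"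
      by (intro card_mono) auto
    also have "\<dots> \<le> card ?T * 2 ^ (n - m)"
      using n by (intro card_extensions) auto
    finally have "real (card (ones_below n ` A \<inter> ones_below n ` B)) \<le> real (card ?T * 2 ^ (n - m))"
      by (rule of_nat_mono)
    also have "\<dots> = real (card ?T) * 2 ^ (n - m)"
      by simp
    also have "\<dots> \<le> r / 2 * 2 ^ m * 2 ^ (n - m)"
      using m by (intro mult_right_mono) auto
    also have "\<dots> = r / 2 * 2 ^ n"
      using n by (simp add: power_add[symmetric])
    also have "\<dots> < r * 2 ^ n"
      using \<open>0 < r\<close> by simp
    finally show "norm (real (card (ones_below n ` A \<inter> ones_below n ` B)) / 2 ^ n - 0) < r"
      by (simp add: divide_less_eq)
  qed
qed


section \<open>Finite combinations of point masses\<close>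

definition atomic :: "'a set \<Rightarrow> ('a \<Rightarrow> real) \<Rightarrow> 'a set \<Rightarrow> real" where
  "atomic F w A = (\<Sum>x\<in>F. w x * indicator A x)"

lemma space_borel_of [simp]: "space (borel_of X) = topspace X"
  unfolding borel_of_def by (intro space_measure_of) (auto dest: openin_subset)

lemma sets_borel_of: "sets (borel_of X) = sigma_sets (topspace X) {U. openin X U}"
  unfolding borel_of_def by (intro sets_measure_of) (auto dest: openin_subset)

lemma openin_in_borel_of: "openin X U \<Longrightarrow> U \<in> sets (borel_of X)"
  unfolding sets_borel_of by (blast intro: sigma_sets.Basic)

lemma finite_in_borel_of:
  assumes "Hausdorff_space X" "finite C" "C \<subseteq> topspace X"
  shows "C \<in> sets (borel_of X)"
proof -
  have "openin X (topspace X - C)"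
    using assms by (simp add: closedin_Hausdorff_finite openin_diff)
  then have "space (borel_of X) - (topspace X - C) \<in> sets (borel_of X)"
    by (intro sets.compl_sets openin_in_borel_of)
  moreover have "space (borel_of X) - (topspace X - C) = C"
    using assms(3) by auto
  ultimately show ?thesis
    by simp
qed

lemma continuous_map_borel_of:
  assumes "continuous_map X euclideanreal f"
  shows "f \<in> borel_measurable (borel_of X)"
proof (rule borel_measurableI)
  fix S :: "real set" assume "open S"
  then have "openin X {x \<in> topspace X. f x \<in> S}"
    using assms openin_continuous_map_preimage by fastforce
  moreover have "f -` S \<inter> space (borel_of X) = {x \<in> topspace X. f x \<in> S}"
    by auto
  ultimately show "f -` S \<inter> space (borel_of X) \<in> sets (borel_of X)"
    by (simp add: openin_in_borel_of)
qed

lemma atomic_uminus: "- atomic F w A = atomic F (\<lambda>x. - w x) A"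
  by (simp add: atomic_def sum_negf)

lemma atomic_eq: "finite F \<Longrightarrow> atomic F w A = (\<Sum>x\<in>F \<inter> A. w x)"
  unfolding atomic_def by (simp add: sum.inter_restrict indicator_def of_bool_def if_distrib cong: if_cong)

lemma signed_measure_atomic:
  assumes "finite F"
  shows "signed_measure M (atomic F w)"
  unfolding signed_measure_def
proof (intro conjI allI impI)
  fix A :: "nat \<Rightarrow> 'a set"
  assume A: "range A \<subseteq> sets M \<and> disjoint_family A"
  show "(\<lambda>n. atomic F w (A n)) sums atomic F w (\<Union>n. A n)"
    unfolding atomic_def
  proof (intro sums_sum sums_mult)
    fix x
    show "(\<lambda>n. indicator (A n) x :: real) sums indicator (\<Union>n. A n) x"
    proof (cases "\<exists>k. x \<in> A k")
      case True
      then obtain k where k: "x \<in> A k" by blast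
      have "(\<lambda>n. indicator (A n) x :: real) = (\<lambda>n. if n = k then 1 else 0)"
      proof
        fix n show "indicator (A n) x = (if n = k then 1 else 0 :: real)"
          using A k by (auto simp: indicator_def disjoint_family_on_def)
      qed
      then show ?thesis
        using sums_single[of k "\<lambda>_. 1 :: real"] True by (simp add: indicator_def)
    qed (simp add: indicator_def)
  qed
qed (simp add: atomic_def)

text \<open>The supremum in the definition of the positive part is attained at the finite set of points of
  \<open>A\<close> with nonnegative weight.\<close>

lemma emeasure_positive_part_atomic:
  assumes "Hausdorff_space X" "finite F" "F \<subseteq> topspace X" "A \<in> sets (borel_of X)"
  shows "emeasure (positive_part (borel_of X) (atomic F w)) A = ennreal (\<Sum>x\<in>F \<inter> A. max 0 (w x))"
proof -
  let ?P = "{x \<in> F \<inter> A. 0 \<le> w x}"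
  have "(SUP B\<in>{B \<in> sets (borel_of X). B \<subseteq> A}. ennreal (atomic F w B)) = ennreal (\<Sum>x\<in>F \<inter> A. max 0 (w x))"
  proof (rule antisym)
    show "(SUP B\<in>{B \<in> sets (borel_of X). B \<subseteq> A}. ennreal (atomic F w B)) \<le> ennreal (\<Sum>x\<in>F \<inter> A. max 0 (w x))"
    proof (intro SUP_least ennreal_leI)
      fix B assume "B \<in> {B \<in> sets (borel_of X). B \<subseteq> A}"
      then have "B \<subseteq> A" by simp
      have "atomic F w B \<le> (\<Sum>x\<in>F \<inter> B. max 0 (w x))"
        unfolding atomic_eq[OF assms(2)] by (intro sum_mono) auto
      also have "\<dots> \<le> (\<Sum>x\<in>F \<inter> A. max 0 (w x))"
        using \<open>B \<subseteq> A\<close> assms(2) by (intro sum_mono2) auto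
      finally show "atomic F w B \<le> (\<Sum>x\<in>F \<inter> A. max 0 (w x))" .
    qed
    have "(\<Sum>x\<in>F \<inter> A. max 0 (w x)) = atomic F w ?P"
      unfolding atomic_eq[OF assms(2)] using assms(2)
      by (intro sum.mono_neutral_cong_right) auto
    moreover have "?P \<in> sets (borel_of X)"
      using assms by (intro finite_in_borel_of) auto
    ultimately show "ennreal (\<Sum>x\<in>F \<inter> A. max 0 (w x)) \<le> (SUP B\<in>{B \<in> sets (borel_of X). B \<subseteq> A}. ennreal (atomic F w B))"
      by (auto intro!: SUP_upper2[of ?P])
  qed
  then show ?thesis
    using emeasure_positive_part[OF signed_measure_atomic[OF assms(2)] assms(4)] by simp
qed

lemma variation_atomic:
  assumes "Hausdorff_space X" "finite F" "F \<subseteq> topspace X" "A \<in> sets (borel_of X)"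
  shows "variation (borel_of X) (atomic F w) A = ennreal (\<Sum>x\<in>F \<inter> A. \<bar>w x\<bar>)"
proof -
  have "(\<Sum>x\<in>F \<inter> A. max 0 (w x)) + (\<Sum>x\<in>F \<inter> A. max 0 (- w x)) = (\<Sum>x\<in>F \<inter> A. \<bar>w x\<bar>)"
    unfolding sum.distrib[symmetric] by (intro sum.cong) auto
  then show ?thesis
    unfolding variation_def negative_part_def atomic_uminus
    using emeasure_positive_part_atomic[OF assms]
    by (simp add: ennreal_plus[symmetric] sum_nonneg del: ennreal_plus)
qed

lemma signed_Radon_measure_atomic:
  assumes "Hausdorff_space X" "finite F" "F \<subseteq> topspace X"
  shows "signed_Radon_measure X (atomic F w)"
  unfolding signed_Radon_measure_def
proof (intro conjI ballI allI impI)
  show "signed_measure (borel_of X) (atomic F w)"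
    using assms(2) by (rule signed_measure_atomic)
next
  fix A and \<epsilon> :: ennreal
  assume A: "A \<in> sets (borel_of X)" "0 < \<epsilon>"
  have C: "A \<inter> F \<in> sets (borel_of X)"
    using assms by (intro finite_in_borel_of) auto
  have "variation (borel_of X) (atomic F w) (A - A \<inter> F) = ennreal (\<Sum>x\<in>F \<inter> (A - A \<inter> F). \<bar>w x\<bar>)"
    using A C by (intro variation_atomic[OF assms]) auto
  also have "F \<inter> (A - A \<inter> F) = {}"
    by blast
  finally have "variation (borel_of X) (atomic F w) (A - A \<inter> F) < \<epsilon>"
    using A by simp
  moreover have "compactin X (A \<inter> F)"
    using assms by (intro finite_imp_compactin) auto
  ultimately show "\<exists>C\<in>sets (borel_of X). compactin X C \<and> C \<subseteq> A \<and> variation (borel_of X) (atomic F w) (A - C) < \<epsilon>"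
    using C by blast
qed

lemma measure_support_atomic:
  assumes "Hausdorff_space X" "finite F" "F \<subseteq> topspace X"
  shows "measure_support X (atomic F w) \<subseteq> F"
proof (rule ccontr)
  assume "\<not> measure_support X (atomic F w) \<subseteq> F"
  then obtain x where x: "x \<in> measure_support X (atomic F w)" "x \<notin> F"
    by blast
  have U: "openin X (topspace X - F)"
    using assms by (simp add: closedin_Hausdorff_finite openin_diff)
  then have "variation (borel_of X) (atomic F w) (topspace X - F) > 0"
    using x by (auto simp: measure_support_def)
  moreover have "variation (borel_of X) (atomic F w) (topspace X - F) = 0"
    by (simp add: variation_atomic[OF assms openin_in_borel_of[OF U]])
  ultimately show False
    by simp
qed

lemma integral_positive_part_atomic:
  assumes "Hausdorff_space X" "finite F" "F \<subseteq> topspace X" "continuous_map X euclideanreal f"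
  shows "(LINT x|positive_part (borel_of X) (atomic F w). f x) = (\<Sum>x\<in>F. max 0 (w x) * f x)"
proof -
  let ?M = "positive_part (borel_of X) (atomic F w)"
  have sets: "sets ?M = sets (borel_of X)"
    unfolding positive_part_def by (rule sets.sets_measure_of_eq)
  have sp: "space ?M = topspace X"
    using sets_eq_imp_space_eq[OF sets] by simp
  have F: "F \<in> sets ?M"
    using finite_in_borel_of[OF assms(1-3)] sets by simp
  have point: "{x} \<in> sets ?M" "emeasure ?M {x} = ennreal (max 0 (w x))" if "x \<in> F" for x
  proof -
    have *: "{x} \<in> sets (borel_of X)"
      using that assms by (intro finite_in_borel_of) auto
    then show "{x} \<in> sets ?M"
      using sets by simp
    show "emeasure ?M {x} = ennreal (max 0 (w x))"
      using emeasure_positive_part_atomic[OF assms(1-3) *, of w] that by simp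
  qed
  have f: "f \<in> borel_measurable ?M"
    using continuous_map_borel_of[OF assms(4)] measurable_cong_sets[OF sets refl] by blast
  have null: "emeasure ?M (space ?M - F) = 0"
  proof -
    have "space ?M - F \<in> sets (borel_of X)"
      using F sets by blast
    from emeasure_positive_part_atomic[OF assms(1-3) this, of w] show ?thesis
      by simp
  qed
  have "(LINT x|?M. f x) = (LINT x|?M. f x * indicator F x)"
  proof (rule integral_cong_AE)
    show "AE x in ?M. f x = f x * indicator F x"
      by (rule AE_I[OF _ null]) (use F in \<open>auto simp: indicator_def\<close>)
  qed (use f F in measurable)
  also have "\<dots> = (\<Sum>x\<in>F. f x * measure ?M {x})"
    using assms(2) point by (intro integral_indicator_finite_real) auto
  also have "\<dots> = (\<Sum>x\<in>F. max 0 (w x) * f x)"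
    using point(2) by (intro sum.cong) (simp_all add: measure_def)
  finally show ?thesis .
qed

lemma signed_integral_atomic:
  assumes "Hausdorff_space X" "finite F" "F \<subseteq> topspace X" "continuous_map X euclideanreal f"
  shows "signed_integral (borel_of X) (atomic F w) f = (\<Sum>x\<in>F. w x * f x)"
proof -
  have "max 0 (w x) * f x - max 0 (- w x) * f x = w x * f x" for x
    by (auto simp: max_def)
  then show ?thesis
    unfolding signed_integral_def negative_part_def atomic_uminus
      integral_positive_part_atomic[OF assms] sum_subtractf[symmetric] by simp
qed


section \<open>Null sequences of lifted point masses\<close>

text \<open>In a compact Hausdorff space quasi-components are connected, so in a totally disconnected one
  they are singletons, and compactness allows the closed complement of \<open>V\<close> to be separated from \<open>x\<close>.\<close>

lemma clopen_base:
  assumes "compact_space X" "Hausdorff_space X" "totally_disconnected_space X"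
    and "openin X V" "x \<in> V"
  obtains U where "closedin X U" "openin X U" "x \<in> U" "U \<subseteq> V"
proof -
  have x: "x \<in> topspace X"
    using assms(4,5) openin_subset by blast
  have eq: "quasi_components_of X = connected_components_of X"
    using assms(1,2) by (intro quasi_eq_connected_components_of) auto
  define Q where "Q = quasi_component_of_set X x"
  have Q: "Q \<in> quasi_components_of X" "x \<in> Q"
    using x by (simp_all add: Q_def quasi_component_in_quasi_components_of)
  then have "connectedin X Q"
    using eq connectedin_connected_components_of by metis
  then have "Q = {x}"
    using Q(2) assms(3) unfolding totally_disconnected_space_def by blast
  moreover have "compactin X (topspace X - V)"
    using assms(1,4) by (intro closedin_compact_space) auto
  ultimately have "separated_between X {x} (topspace X - V)"
    using separated_between_quasi_component_compact[OF Q(1)] assms(5) by (auto simp: disjnt_def)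
  then obtain U where "closedin X U" "openin X U" "{x} \<subseteq> U" "topspace X - V \<subseteq> topspace X - U"
    unfolding separated_between by blast
  moreover from this have "U \<subseteq> V"
    using openin_subset by blast
  ultimately show ?thesis
    using that by simp
qed

lemma clopen_cover_small_oscillation:
  assumes "compact_space X" "Hausdorff_space X" "totally_disconnected_space X"
    and g: "continuous_map X euclideanreal g" and "0 < \<epsilon>"
  obtains \<U> where "finite \<U>" "topspace X = \<Union>\<U>"
    "\<And>U. U \<in> \<U> \<Longrightarrow> closedin X U \<and> openin X U"
    "\<And>U u v. U \<in> \<U> \<Longrightarrow> u \<in> U \<Longrightarrow> v \<in> U \<Longrightarrow> \<bar>g u - g v\<bar> < \<epsilon>"
proof -
  define \<V> where "\<V> = {U. closedin X U \<and> openin X U \<and> (\<forall>u\<in>U. \<forall>v\<in>U. \<bar>g u - g v\<bar> < \<epsilon>)}"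
  have "\<exists>U\<in>\<V>. x \<in> U" if x: "x \<in> topspace X" for x
  proof -
    let ?V = "{y \<in> topspace X. g y \<in> ball (g x) (\<epsilon> / 2)}"
    have "openin X ?V"
      using g by (rule openin_continuous_map_preimage) simp
    then obtain U where U: "closedin X U" "openin X U" "x \<in> U" "U \<subseteq> ?V"
      using clopen_base[OF assms(1-3), of ?V x] x \<open>0 < \<epsilon>\<close> by auto
    have "\<bar>g u - g v\<bar> < \<epsilon>" if "u \<in> U" "v \<in> U" for u v
    proof -
      have "\<bar>g x - g u\<bar> < \<epsilon> / 2" "\<bar>g x - g v\<bar> < \<epsilon> / 2"
        using U(4) that by (auto simp: dist_real_def)
      then show ?thesis
        by linarith
    qed
    then show ?thesis
      using U by (auto simp: \<V>_def)
  qed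
  then have "topspace X \<subseteq> \<Union>\<V>"
    by blast
  then obtain \<U> where \<U>: "finite \<U>" "\<U> \<subseteq> \<V>" "topspace X \<subseteq> \<Union>\<U>"
    using compactinD[of X "topspace X" \<V>] assms(1) by (auto simp: \<V>_def compact_space_def)
  have clopen: "closedin X U \<and> openin X U" if "U \<in> \<U>" for U
    using that \<U>(2) unfolding \<V>_def by blast
  have osc: "\<bar>g u - g v\<bar> < \<epsilon>" if "U \<in> \<U>" "u \<in> U" "v \<in> U" for U u v
    using that \<U>(2) unfolding \<V>_def by blast
  have "\<Union>\<U> \<subseteq> topspace X"
    using clopen openin_subset by blast
  then have "topspace X = \<Union>\<U>"
    using \<U>(3) by (rule subset_antisym[symmetric])
  from that[OF \<U>(1) this clopen osc] show ?thesis .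
qed

text \<open>Choose two points of the Cantor space in each cylinder of level \<open>n\<close>, lift them arbitrarily to \<open>X\<close>,
  and give one lift the weight \<open>1 / 2 ^ Suc n\<close> and the other the negative of it. A clopen set \<open>U\<close>
  separates the two lifts only if the cylinder meets both \<open>f ` U\<close> and \<open>f ` (topspace X - U)\<close>. As
  the intersection of these closed sets is small, this happens for a vanishing proportion of the
  cylinders, and in all others the two contributions nearly cancel.\<close>

theorem fsJNP_if_small_overlaps:
  assumes "compact_space X" "Hausdorff_space X" "totally_disconnected_space X"
    and f: "continuous_map X cantor_space f" and surj: "f ` topspace X = UNIV"
    and small: "\<And>U. closedin X U \<Longrightarrow> openin X U \<Longrightarrow> |f ` U \<inter> f ` (topspace X - U)| <o continuum"
  shows "fsJNP X"
proof -
  have "\<forall>c. \<exists>x\<in>topspace X. f x = c"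
    using surj by (metis UNIV_I imageE)
  then obtain s where s: "\<And>c. s c \<in> topspace X" "\<And>c. f (s c) = c"
    by metis
  \<comment> \<open>The lift \<open>y n S\<close> continues the digits \<open>S\<close> by zeros and \<open>y' n S\<close> continues them by ones, so that
    digit \<open>n\<close> of the image tells the two kinds of lifts apart.\<close>
  define y where "y n S = s (\<lambda>i. i \<in> S)" for n :: nat and S
  define y' where "y' n S = s (\<lambda>i. i \<in> S \<or> n \<le> i)" for n S
  have ones_below_y: "ones_below n (f (y n S)) = S" "ones_below n (f (y' n S)) = S" if "S \<in> Pow {..<n}" for n S
    using that by (auto simp: y_def y'_def s(2) ones_below_def)
  have inj: "inj_on (y n) (Pow {..<n})" "inj_on (y' n) (Pow {..<n})" for n
    by (auto intro!: inj_on_inverseI[where g = "\<lambda>x. ones_below n (f x)"] simp: ones_below_y)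
  define F where "F n = y n ` Pow {..<n} \<union> y' n ` Pow {..<n}" for n
  define w where "w n x = (if f x n then - (1 / 2 ^ Suc n) else 1 / 2 ^ Suc n :: real)" for n x
  have w: "w n (y n S) = 1 / 2 ^ Suc n" "w n (y' n S) = - (1 / 2 ^ Suc n)" if "S \<in> Pow {..<n}" for n S
    using that by (auto simp: w_def y_def y'_def s(2))
  have F: "finite (F n)" "F n \<subseteq> topspace X" for n
    using s(1) by (auto simp: F_def y_def y'_def)
  have disj: "y n ` Pow {..<n} \<inter> y' n ` Pow {..<n} = {}" for n
  proof -
    have "y n S \<noteq> y' n T" if "S \<in> Pow {..<n}" "T \<in> Pow {..<n}" for S T
      using w(1)[OF that(1)] w(2)[OF that(2)] by auto
    then show ?thesis
      by blast
  qed
  have sum_F: "(\<Sum>x\<in>F n. h x) = (\<Sum>S\<in>Pow {..<n}. h (y n S) + h (y' n S))" for n and h :: "'a \<Rightarrow> real"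
    unfolding F_def using inj[of n] disj[of n]
    by (subst sum.union_disjoint) (simp_all add: sum.reindex sum.distrib)
  have tendsto: "(\<lambda>n. \<Sum>x\<in>F n. w n x * g x) \<longlonglongrightarrow> 0" if g: "continuous_map X euclideanreal g" for g
  proof (rule LIMSEQ_I)
    fix r :: real assume "0 < r"
    obtain \<U> where \<U>: "finite \<U>" "topspace X = \<Union>\<U>"
      "\<And>U. U \<in> \<U> \<Longrightarrow> closedin X U \<and> openin X U"
      "\<And>U u v. U \<in> \<U> \<Longrightarrow> u \<in> U \<Longrightarrow> v \<in> U \<Longrightarrow> \<bar>g u - g v\<bar> < r"
      using clopen_cover_small_oscillation[OF assms(1-3) g \<open>0 < r\<close>] by blast
    have "compact (g ` topspace X)"
      using image_compactin[OF _ g] assms(1) unfolding compact_space_def by (metis compactin_euclidean_iff)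
    then obtain M where M: "0 < M" "\<And>x. x \<in> topspace X \<Longrightarrow> \<bar>g x\<bar> \<le> M"
      using compact_imp_bounded bounded_pos by (metis image_eqI real_norm_def)
    \<comment> \<open>\<open>Bad n U\<close> contains the code of every cylinder whose two lifts are separated by \<open>U\<close>.\<close>
    define Bad where "Bad n U = ones_below n ` (f ` U) \<inter> ones_below n ` (f ` (topspace X - U))" for n U
    have Bad: "(\<lambda>n. real (card (Bad n U)) / 2 ^ n) \<longlonglongrightarrow> 0" if "U \<in> \<U>" for U
      unfolding Bad_def
    proof (rule common_cylinders_density)
      have "closedin cantor_space (f ` C)" if "closedin X C" for C
        using image_compactin[OF closedin_compact_space[OF assms(1) that] f] Hausdorff_cantor
          compactin_imp_closedin by blast
      then show "closedin cantor_space (f ` U)" "closedin cantor_space (f ` (topspace X - U))"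
        using \<U>(3)[OF that] by auto
      show "|f ` U \<inter> f ` (topspace X - U)| <o continuum"
        using small \<U>(3)[OF that] by blast
    qed
    have "(\<lambda>n. \<Sum>U\<in>\<U>. real (card (Bad n U)) / 2 ^ n) \<longlonglongrightarrow> (\<Sum>U\<in>\<U>. 0)"
      by (intro tendsto_sum Bad)
    then have lim: "(\<lambda>n. \<Sum>U\<in>\<U>. real (card (Bad n U)) / 2 ^ n) \<longlonglongrightarrow> 0"
      by simp
    obtain N where N: "\<And>n. n \<ge> N \<Longrightarrow> (\<Sum>U\<in>\<U>. real (card (Bad n U)) / 2 ^ n) < r / (2 * M)"
      using order_tendstoD(2)[OF lim, of "r / (2 * M)"] \<open>0 < r\<close> M(1)
      unfolding eventually_sequentially by auto
    have "norm ((\<Sum>x\<in>F n. w n x * g x) - 0) < r" if "n \<ge> N" for n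
    proof -
      let ?P = "Pow {..<n}" and ?B = "\<Union>U\<in>\<U>. Bad n U"
      have top: "y n S \<in> topspace X" "y' n S \<in> topspace X" for S
        using s(1) by (simp_all add: y_def y'_def)
      have B: "?B \<subseteq> ?P" "finite ?B"
        using ones_below_subset \<U>(1) unfolding Bad_def by auto
      \<comment> \<open>Outside the bad cylinders both lifts lie in a common member of \<open>\<U>\<close>.\<close>
      have bound: "\<bar>g (y n S) - g (y' n S)\<bar> \<le> r + 2 * M * indicator ?B S" if S: "S \<in> ?P" for S
      proof (cases "S \<in> ?B")
        case True
        then show ?thesis
          using M(2)[OF top(1), of S] M(2)[OF top(2), of S] \<open>0 < r\<close> by simp
      next
        case False
        obtain U where U: "U \<in> \<U>" "y n S \<in> U"
          using top(1) \<U>(2) by blast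
        have "y' n S \<in> U"
        proof (rule ccontr)
          assume "y' n S \<notin> U"
          then have "ones_below n (f (y' n S)) \<in> ones_below n ` (f ` (topspace X - U))"
            using top(2) by blast
          moreover have "ones_below n (f (y n S)) \<in> ones_below n ` (f ` U)"
            using U(2) by blast
          ultimately have "S \<in> Bad n U"
            unfolding Bad_def ones_below_y[OF S] by blast
          then show False
            using False U(1) by blast
        qed
        then show ?thesis
          using \<U>(4)[OF U] M(1) False by (simp add: less_imp_le)
      qed
      have "(\<Sum>x\<in>F n. w n x * g x) = (\<Sum>S\<in>?P. 1 / 2 ^ Suc n * (g (y n S) - g (y' n S)))"
        unfolding sum_F by (intro sum.cong) (simp_all add: w right_diff_distrib)
      then have "\<bar>\<Sum>x\<in>F n. w n x * g x\<bar> \<le> (\<Sum>S\<in>?P. 1 / 2 ^ Suc n * \<bar>g (y n S) - g (y' n S)\<bar>)"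
        using sum_abs[of "\<lambda>S. 1 / 2 ^ Suc n * (g (y n S) - g (y' n S))" ?P] by (simp add: abs_mult)
      also have "\<dots> \<le> (\<Sum>S\<in>?P. 1 / 2 ^ Suc n * (r + 2 * M * indicator ?B S))"
        by (intro sum_mono mult_left_mono bound) auto
      also have "\<dots> = 1 / 2 ^ Suc n * (2 ^ n * r + 2 * M * card ?B)"
      proof -
        have "(\<Sum>S\<in>?P. indicator ?B S :: real) = (\<Sum>S\<in>?B. 1)"
          using B(1) by (intro sum.mono_neutral_cong_right) (auto simp: indicator_def)
        then have "(\<Sum>S\<in>?P. indicator ?B S :: real) = card ?B"
          by simp
        then show ?thesis
          unfolding sum_distrib_left[symmetric] sum.distrib by (simp add: card_Pow)
      qed
      also have "\<dots> = r / 2 + M * (card ?B / 2 ^ n)"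
        by (simp add: field_simps)
      also have "\<dots> \<le> r / 2 + M * (\<Sum>U\<in>\<U>. real (card (Bad n U)) / 2 ^ n)"
      proof -
        have "real (card ?B) \<le> real (\<Sum>U\<in>\<U>. card (Bad n U))"
          by (intro of_nat_mono card_UN_le \<U>(1))
        then have "real (card ?B) / 2 ^ n \<le> (\<Sum>U\<in>\<U>. real (card (Bad n U))) / 2 ^ n"
          by (simp add: divide_right_mono)
        also have "\<dots> = (\<Sum>U\<in>\<U>. real (card (Bad n U)) / 2 ^ n)"
          by (rule sum_divide_distrib)
        finally show ?thesis
          by (rule add_left_mono[OF mult_left_mono]) (use M(1) in simp)
      qed
      also have "\<dots> < r / 2 + M * (r / (2 * M))"
        by (intro add_strict_left_mono mult_strict_left_mono N[OF that] M(1))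
      also have "\<dots> = r"
        using M(1) by simp
      finally show ?thesis
        by simp
    qed
    then show "\<exists>N. \<forall>n\<ge>N. norm ((\<Sum>x\<in>F n. w n x * g x) - 0) < r"
      by blast
  qed
  have norm: "(\<Sum>x\<in>F n. \<bar>w n x\<bar>) = 1" for n
  proof -
    have "(\<Sum>x\<in>F n. \<bar>w n x\<bar>) = (\<Sum>S\<in>Pow {..<n}. 1 / 2 ^ n)"
      unfolding sum_F by (intro sum.cong) (simp_all add: w)
    then show ?thesis
      by (simp add: card_Pow)
  qed
  show ?thesis
    unfolding fsJNP_def
  proof (intro exI[of _ "\<lambda>n. atomic (F n) (w n)"] conjI allI impI)
    fix n
    show "signed_Radon_measure X (atomic (F n) (w n))"
      using assms(2) F by (rule signed_Radon_measure_atomic)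
    show "finite (measure_support X (atomic (F n) (w n)))"
      using measure_support_atomic[OF assms(2) F] F(1) finite_subset by blast
    show "total_variation_norm (borel_of X) (atomic (F n) (w n)) = 1"
    proof -
      have "F n \<inter> topspace X = F n"
        using F(2) by blast
      then show ?thesis
        using variation_atomic[OF assms(2) F openin_in_borel_of[OF openin_topspace], of n "w n"]
        by (simp add: total_variation_norm_def norm)
    qed
  next
    fix g assume "continuous_map X euclideanreal g"
    then show "(\<lambda>n. signed_integral (borel_of X) (atomic (F n) (w n)) g) \<longlonglongrightarrow> 0"
      using tendsto by (simp add: signed_integral_atomic[OF assms(2) F])
  qed
qed


section \<open>Systems of simple extensions\<close>

theorem theorem9p19:
  fixes \<tau> :: "'t rel"
    and \<delta> :: "'i::wellorder"
    and K :: "'i \<Rightarrow> 'a topology"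
    and \<pi> :: "'i \<Rightarrow> 'i \<Rightarrow> 'a \<Rightarrow> 'a"
  assumes "Card_order \<tau>" and "\<tau> <o continuum"
    and "simple_extension_system \<tau> \<delta> K \<pi>"
    and "ordinal_of \<delta> \<le>o continuum"
  shows "fsJNP (K \<delta>)"
proof -
  interpret simple_extension_system \<tau> \<delta> K \<pi>
    by (rule assms(3))
  obtain h where h: "homeomorphic_map (K ord_zero) cantor_space h"
    using zero homeomorphic_space by blast
  let ?f = "h \<circ> \<pi> ord_zero \<delta>" and ?T = "topspace (K \<delta>)"
  show ?thesis
  proof (rule fsJNP_if_small_overlaps)
    show "compact_space (K \<delta>)" "Hausdorff_space (K \<delta>)" "totally_disconnected_space (K \<delta>)"
      by (simp_all add: compact Hausdorff totally_disconnected)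
    show "continuous_map (K \<delta>) cantor_space ?f"
      using continuous[OF ord_zero_le order_refl] homeomorphic_imp_continuous_map[OF h]
      by (rule continuous_map_compose)
    show "?f ` ?T = UNIV"
      using bonding_surj[OF ord_zero_le order_refl] homeomorphic_imp_surjective_map[OF h]
      unfolding image_comp[symmetric] by simp
    fix U assume U: "closedin (K \<delta>) U" "openin (K \<delta>) U"
    have sub: "\<pi> ord_zero \<delta> ` V \<subseteq> topspace (K ord_zero)" if "V \<subseteq> ?T" for V
      using bonding_surj[OF ord_zero_le order_refl] that by blast
    have "?f ` U \<inter> ?f ` (?T - U) = h ` overlap U ord_zero"
      unfolding overlap_def image_comp[symmetric]
      using closedin_subset[OF U(1)]
      by (intro inj_on_image_Int[OF homeomorphic_imp_injective_map[OF h], symmetric] sub) auto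
    then show "|?f ` U \<inter> ?f ` (?T - U)| <o continuum"
      using card_overlap_zero[OF U assms(1,2,4)] card_of_image ordLeq_ordLess_trans by metis
  qed
qed

end
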